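(* Let $\Phi$ be a strictly pluri-subharmonic quadratic form on $\mathbf{C}^n$ and let $a\in S(\Lambda_\Phi)$. The operator $\mathrm{Op}_h^w(a)$ extends to a bounded operator $H_\Phi(\mathbf{C}^n)\to H_\Phi(\mathbf{C}^n)$, whose norm is $\mathcal{O}(1)$ as $h\to0^+$.
   Context: $\Phi$ is a real-valued quadratic form on $\mathbf{C}^n\simeq\mathbf{R}^{2n}$ with $\sum_{j,k}\frac{\partial^2\Phi}{\partial\bar x_j\partial x_k}\bar\xi_j\xi_k>0$ for all $0\ne\xi\in\mathbf{C}^n$. $\Lambda_\Phi=\{(x,\frac{2}{i}\frac{\partial\Phi}{\partial x}(x));\ x\in\mathbf{C}^n\}\subset\mathbf{C}^{2n}$, identified (real-)linearly with $\mathbf{C}^n$ by the projection $(x,\xi)\mapsto x$; $S(\Lambda_\Phi)=\{a\in C^\infty(\Lambda_\Phi);\ \partial^\alpha a=\mathcal{O}_\alpha(1)\ \forall\alpha\}$. $H_\Phi(\mathbf{C}^n)=\operatorname{Hol}(\mathbf{C}^n)\cap L^2(\mathbf{C}^n,e^{-2\Phi/h}L(dx))$, with $L(dx)$ the Lebesgue measure and $\operatorname{Hol}(\mathbf{C}^n)$ the entire functions; $0<h\le1$. For $u\in\operatorname{Hol}(\mathbf{C}^n)$ with $u=\mathcal{O}_{h,N}(1)\langle x\rangle^{-N}e^{\Phi(x)/h}$ for all $N\ge0$, one sets $$\mathrm{Op}_h^w(a)u(x)=\frac{1}{(2\pi h)^n}\iint_{\Gamma(x)}e^{\frac{i}{h}(x-y)\cdot\theta}a\Big(\frac{x+y}{2},\theta\Big)u(y)\,dy\wedge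 d\theta,$$ where $\Gamma(x)$ is the $2n$-dimensional contour $\theta=\frac{2}{i}\frac{\partial\Phi}{\partial x}\big(\frac{x+y}{2}\big)$ parametrized by $y\in\mathbf{C}^n$, oriented so that $dy\wedge d\theta|_{\Gamma(x)}=\frac{1}{i^n}\det(\Phi''_{x\bar x})\,dy\wedge d\bar y$ is a positive multiple of $L(dy)$. Here $\langle x\rangle=(1+|x|^2)^{1/2}$, and $X\cdot Y=\sum_jX_jY_j$ is the complex bilinear product. *)

theory Defs
  imports "HOL-Analysis.Analysis" "HOL-Library.Landau_Symbols"
begin

text \<open>Throughout, \<open>C\<^sup>n\<close> is the type \<open>complex ^ 'n\<close>, a real Euclidean space of dimension \<open>2 n\<close>
  whose measure \<open>lborel\<close> is Lebesgue measure \<open>L(dx)\<close>. Derivatives without further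
  qualification are real ones.\<close>

definition quadratic_form :: "('a::real_vector \<Rightarrow> real) \<Rightarrow> bool" where
  "quadratic_form \<Phi> \<longleftrightarrow> (\<exists>B. bilinear B \<and> (\<forall>x. \<Phi> x = B x x))"

text \<open>The Wirtinger derivatives
  \<open>\<partial>/\<partial>x\<^sub>j = (\<partial>/\<partial>Re x\<^sub>j - \<i> \<partial>/\<partial>Im x\<^sub>j)/2\<close> and
  \<open>\<partial>/\<partial>(cnj x\<^sub>j) = (\<partial>/\<partial>Re x\<^sub>j + \<i> \<partial>/\<partial>Im x\<^sub>j)/2\<close>.\<close>

definition wirt :: "'n \<Rightarrow> (complex ^ 'n \<Rightarrow> complex) \<Rightarrow> complex ^ 'n \<Rightarrow> complex" where
  "wirt j f x = (frechet_derivative f (at x) (axis j 1)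
                 - \<i> * frechet_derivative f (at x) (axis j \<i>)) / 2"

definition wirt_bar :: "'n \<Rightarrow> (complex ^ 'n \<Rightarrow> complex) \<Rightarrow> complex ^ 'n \<Rightarrow> complex" where
  "wirt_bar j f x = (frechet_derivative f (at x) (axis j 1)
                     + \<i> * frechet_derivative f (at x) (axis j \<i>)) / 2"

definition levi_matrix :: "(complex ^ 'n \<Rightarrow> real) \<Rightarrow> complex ^ 'n \<Rightarrow> complex ^ 'n ^ 'n" where
  "levi_matrix \<Phi> x = (\<chi> j k. wirt_bar j (wirt k (\<lambda>z. complex_of_real (\<Phi> z))) x)"

text \<open>The Levi form below is real-valued since \<open>\<Phi>\<close> is, so taking the real part loses nothing.\<close>

definition strictly_psh :: "(complex ^ 'n \<Rightarrow> real) \<Rightarrow> bool" where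
  "strictly_psh \<Phi> \<longleftrightarrow>
     (\<forall>x \<xi>. \<xi> \<noteq> 0 \<longrightarrow>
        Re (\<Sum>j\<in>UNIV. \<Sum>k\<in>UNIV. levi_matrix \<Phi> x $ j $ k * cnj (\<xi> $ j) * \<xi> $ k) > 0)"

text \<open>\<open>\<Lambda>\<^sub>\<Phi>\<close> is the graph of \<open>Lambda_fibre \<Phi>\<close>.\<close>

definition Lambda_fibre :: "(complex ^ 'n \<Rightarrow> real) \<Rightarrow> complex ^ 'n \<Rightarrow> complex ^ 'n" where
  "Lambda_fibre \<Phi> x = (\<chi> j. 2 / \<i> * wirt j (\<lambda>z. complex_of_real (\<Phi> z)) x)"

text \<open>\<open>iter_deriv [v\<^sub>1, \<dots>, v\<^sub>m] f\<close> is \<open>\<partial>\<^bsub>v\<^sub>1\<^esub> \<dots> \<partial>\<^bsub>v\<^sub>m\<^esub> f\<close>. For \<open>f\<close> smooth, the lists over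
  \<open>Basis\<close> give exactly the partial derivatives \<open>\<partial>\<^sup>\<alpha> f\<close> in the real coordinates.\<close>

fun iter_deriv :: "'a list \<Rightarrow> ('a::real_normed_vector \<Rightarrow> 'b::real_normed_vector) \<Rightarrow> 'a \<Rightarrow> 'b" where
  "iter_deriv [] f = f"
| "iter_deriv (v # vs) f = (\<lambda>x. frechet_derivative (iter_deriv vs f) (at x) v)"

definition smooth :: "('a::euclidean_space \<Rightarrow> 'b::real_normed_vector) \<Rightarrow> bool" where
  "smooth f \<longleftrightarrow> (\<forall>vs\<in>lists Basis. \<forall>x. iter_deriv vs f differentiable (at x))"

text \<open>A function on \<open>\<Lambda>\<^sub>\<Phi>\<close> is represented by any function on \<open>C\<^sup>n \<times> C\<^sup>n\<close> with that
  restriction; its values outside \<open>\<Lambda>\<^sub>\<Phi>\<close> are never used. Regularity is expressed in the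
  chart \<open>(x, \<xi>) \<mapsto> x\<close>.\<close>

definition symbol_class :: "(complex ^ 'n \<Rightarrow> real) \<Rightarrow> ((complex ^ 'n) \<times> (complex ^ 'n) \<Rightarrow> complex) set" where
  "symbol_class \<Phi> = {a. let b = (\<lambda>x. a (x, Lambda_fibre \<Phi> x)) in
      smooth b \<and> (\<forall>vs\<in>lists Basis. \<exists>C. \<forall>x. norm (iter_deriv vs b x) \<le> C)}"

definition Hol :: "(complex ^ 'n \<Rightarrow> complex) set" where
  "Hol = {u. \<forall>x. \<exists>D. (u has_derivative D) (at x) \<and> (\<forall>c v. D (c *s v) = c * D v)}"

text \<open>Entire functions are continuous, so an \<open>L\<^sup>2\<close> class has at most one entire
  representative and no quotient is needed.\<close>

definition H_Phi :: "(complex ^ 'n \<Rightarrow> real) \<Rightarrow> real \<Rightarrow> (complex ^ 'n \<Rightarrow> complex) set" where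
  "H_Phi \<Phi> h = {u \<in> Hol. integrable lborel (\<lambda>x. (norm (u x))\<^sup>2 * exp (- 2 * \<Phi> x / h))}"

definition H_norm :: "(complex ^ 'n \<Rightarrow> real) \<Rightarrow> real \<Rightarrow> (complex ^ 'n \<Rightarrow> complex) \<Rightarrow> real" where
  "H_norm \<Phi> h u = sqrt (\<integral>x. (norm (u x))\<^sup>2 * exp (- 2 * \<Phi> x / h) \<partial>lborel)"

definition japanese :: "'a::real_normed_vector \<Rightarrow> real" where
  "japanese x = sqrt (1 + (norm x)\<^sup>2)"

definition rapid_Hol :: "(complex ^ 'n \<Rightarrow> real) \<Rightarrow> real \<Rightarrow> (complex ^ 'n \<Rightarrow> complex) set" where
  "rapid_Hol \<Phi> h =
     {u \<in> Hol. \<forall>N::nat. \<exists>C. \<forall>x. norm (u x) \<le> C * (1 / japanese x ^ N) * exp (\<Phi> x / h)}"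

definition cdot :: "complex ^ 'n \<Rightarrow> complex ^ 'n \<Rightarrow> complex" where
  "cdot X Y = (\<Sum>j\<in>UNIV. X $ j * Y $ j)"

text \<open>The contour \<open>\<Gamma>(x)\<close> is parametrized by \<open>y\<close>. On it,
  \<open>d\<theta>\<^sub>j = (1/\<i>) (\<Sum>k. \<Phi>''(x\<^sub>j, x\<^sub>k) dy\<^sub>k + \<Phi>''(x\<^sub>j, cnj x\<^sub>k) d(cnj y\<^sub>k))\<close>, whence
  \<open>dy \<and> d\<theta> = \<i>\<^sup>-\<^sup>n det \<Phi>''(x, cnj x) dy \<and> d(cnj y)\<close>. As \<open>dy\<^sub>j \<and> d(cnj y\<^sub>j) = (2/\<i>) dRe y\<^sub>j \<and> dIm y\<^sub>j\<close>
  and the Levi matrix is positive definite, the orientation making this a positive multiple of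
  Lebesgue measure gives \<open>2\<^sup>n det \<Phi>''(x, cnj x) L(dy)\<close>.\<close>

definition contour_density :: "(complex ^ 'n \<Rightarrow> real) \<Rightarrow> complex ^ 'n \<Rightarrow> complex" where
  "contour_density \<Phi> z = 2 ^ CARD('n) * det (levi_matrix \<Phi> z)"

definition Op_w :: "(complex ^ 'n \<Rightarrow> real) \<Rightarrow> real \<Rightarrow> ((complex ^ 'n) \<times> (complex ^ 'n) \<Rightarrow> complex)
    \<Rightarrow> (complex ^ 'n \<Rightarrow> complex) \<Rightarrow> complex ^ 'n \<Rightarrow> complex" where
  "Op_w \<Phi> h a u x =
     1 / complex_of_real ((2 * pi * h) ^ CARD('n)) *
     (\<integral>y. (let m = (1 / 2) *\<^sub>R (x + y); \<theta> = Lambda_fibre \<Phi> m in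
        exp (\<i> / complex_of_real h * cdot (x - y) \<theta>) * a (m, \<theta>) * u y * contour_density \<Phi> m)
      \<partial>lborel)"

definition bounded_operator_H :: "(complex ^ 'n \<Rightarrow> real) \<Rightarrow> real
    \<Rightarrow> ((complex ^ 'n \<Rightarrow> complex) \<Rightarrow> complex ^ 'n \<Rightarrow> complex) \<Rightarrow> bool" where
  "bounded_operator_H \<Phi> h T \<longleftrightarrow>
     (\<forall>u\<in>H_Phi \<Phi> h. T u \<in> H_Phi \<Phi> h) \<and>
     (\<forall>u\<in>H_Phi \<Phi> h. \<forall>v\<in>H_Phi \<Phi> h. T (\<lambda>x. u x + v x) = (\<lambda>x. T u x + T v x)) \<and>
     (\<forall>u\<in>H_Phi \<Phi> h. \<forall>c. T (\<lambda>x. c * u x) = (\<lambda>x. c * T u x)) \<and>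
     (\<exists>C. \<forall>u\<in>H_Phi \<Phi> h. H_norm \<Phi> h (T u) \<le> C * H_norm \<Phi> h u)"

definition operator_norm_H :: "(complex ^ 'n \<Rightarrow> real) \<Rightarrow> real
    \<Rightarrow> ((complex ^ 'n \<Rightarrow> complex) \<Rightarrow> complex ^ 'n \<Rightarrow> complex) \<Rightarrow> real" where
  "operator_norm_H \<Phi> h T = (SUP u\<in>{u \<in> H_Phi \<Phi> h. H_norm \<Phi> h u \<le> 1}. H_norm \<Phi> h (T u))"

end

theory Submission
  imports Defs "HOL-Complex_Analysis.Complex_Analysis" "HOL-Probability.Sinc_Integral"
    "HOL-Real_Asymp.Real_Asymp"
begin

text \<open>
  Since \<open>\<Phi>\<close> is quadratic, \<open>\<Phi>(x) - \<Phi>(y)\<close> is exactly the real part of \<open>\<i> (x - y) \<cdot> \<theta>\<close> on the contour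
  \<open>\<Gamma>(x)\<close>. Conjugated by \<open>e\<^bsup>\<Phi>/h\<^esup>\<close>, the kernel of \<open>Op\<^sub>h\<^sup>w(a)\<close> is therefore in modulus a constant times
  \<open>|a|\<close> at the midpoint of \<open>x\<close> and \<open>y\<close>. It need not decay in \<open>x - y\<close> at all, and an estimate by absolute
  values cannot succeed; the holomorphy of the functions acted on has to be used.

  Splitting \<open>\<Phi>(x) = H(x,x) + Re Q(x,x)\<close> into a positive Hermitian form and the real part of a
  holomorphic quadratic form, conjugation by \<open>e\<^bsup>Q/h\<^esup>\<close> and the dilation by \<open>\<surd>h\<close> turn the problem into
  the same one with \<open>h = 1\<close>, weight \<open>H\<close> and symbol \<open>b(\<surd>h x)\<close>, where \<open>b(x) = a(x, \<theta>(x))\<close>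
  (\<open>quadratic_weight_decomposition\<close>, \<open>Op_w_eq\<close>). For \<open>h \<le> 1\<close> the derivatives of \<open>b(\<surd>h x)\<close> are bounded
  uniformly in \<open>h\<close>. This is where the uniform bound on the norm comes from.

  For the weight \<open>H\<close>, a holomorphic function is reproduced by the Bergman projection \<open>\<Pi>\<close>, whose
  conjugated kernel is the Gaussian \<open>e\<^bsup>-H(x-z,x-z)\<^esup>\<close> up to a phase (\<open>bergman_reproduces\<close>). Inserting
  \<open>u = \<Pi> u\<close> replaces the kernel of the Weyl operator by its composition with \<open>\<Pi>\<close>. Up to a phase,
  the conjugated composition is the Fourier transform, at a frequency proportional to \<open>x - z\<close>, of a Gaussian
  times a translate of the symbol. Repeated integration by parts shows that it is
  \<open>O((1 + |x - z|\<^sup>2)\<^sup>-\<^sup>D)\<close> with \<open>D\<close> the real dimension (\<open>weyl_kernel_bound\<close>), and Schur's test gives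
  an operator \<open>W\<close> bounded on the weighted \<open>L\<^sup>2\<close> space.

  The extension is \<open>\<Pi> W\<close>: composing with \<open>\<Pi>\<close> makes every value entire (\<open>Hol_bergman\<close>). On rapidly
  decreasing \<open>u\<close> it agrees with the Weyl operator, because \<open>W u = Op u\<close> by Fubini
  (\<open>weyl_eq_weighted_op\<close>) and because \<open>Op u\<close> is an integral of entire functions of Gaussian growth, each
  of which \<open>\<Pi>\<close> reproduces (\<open>bergman_weyl\<close>).
\<close>

section \<open>Lebesgue measure under affine maps\<close>

lemma nn_integral_lborel_affine:
  fixes f :: "'a::euclidean_space \<Rightarrow> ennreal"
  assumes [measurable]: "f \<in> borel_measurable borel" and c: "c \<noteq> 0"
  shows "(\<integral>\<^sup>+x. f x \<partial>lborel) = ennreal (\<bar>c\<bar> ^ DIM('a)) * (\<integral>\<^sup>+x. f (t + c *\<^sub>R x) \<partial>lborel)"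
  by (subst lborel_affine[OF c, of t])
     (simp add: nn_integral_density nn_integral_distr nn_integral_cmult)

lemma integrable_lborel_affine:
  fixes f :: "'a::euclidean_space \<Rightarrow> 'b :: {banach, second_countable_topology}"
  assumes f: "integrable lborel f" and c: "c \<noteq> 0"
  shows "integrable lborel (\<lambda>x. f (t + c *\<^sub>R x))"
  using f f[THEN borel_measurable_integrable] c unfolding integrable_iff_bounded
  by (subst (asm) nn_integral_lborel_affine[where c=c and t=t])
     (auto simp: ennreal_mult_less_top top_unique ennreal_mult_eq_top_iff)

lemma integrable_lborel_affine_iff:
  fixes f :: "'a::euclidean_space \<Rightarrow> 'b :: {banach, second_countable_topology}"
  assumes c: "c \<noteq> 0"
  shows "integrable lborel (\<lambda>x. f (t + c *\<^sub>R x)) \<longleftrightarrow> integrable lborel f"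
  using integrable_lborel_affine[of f c t] c
    integrable_lborel_affine[of "\<lambda>x. f (t + c *\<^sub>R x)" "1/c" "-(1/c) *\<^sub>R t"]
  by (auto simp add: algebra_simps)

lemma integral_lborel_affine:
  fixes f :: "'a::euclidean_space \<Rightarrow> 'b :: {banach, second_countable_topology}"
  assumes c: "c \<noteq> 0"
  shows "(\<integral>x. f x \<partial>lborel) = \<bar>c\<bar> ^ DIM('a) *\<^sub>R (\<integral>x. f (t + c *\<^sub>R x) \<partial>lborel)"
proof cases
  assume f[measurable]: "integrable lborel f"
  then show ?thesis
    using c f f[THEN borel_measurable_integrable] integrable_lborel_affine[OF f c, of t]
    by (subst lborel_affine[OF c, of t]) (simp add: integral_density integral_distr)
next
  assume "\<not> integrable lborel f"
  with c show ?thesis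
    by (simp add: integrable_lborel_affine_iff not_integrable_integral_eq)
qed

lemmas integral_lborel_translate = integral_lborel_affine[of 1, simplified]
lemmas integrable_lborel_translate = integrable_lborel_affine[of _ 1, simplified]
lemmas nn_integral_lborel_translate = nn_integral_lborel_affine[of _ 1, simplified]

lemma integrable_pair_mult:
  fixes f :: "'a::euclidean_space \<Rightarrow> real" and g :: "'b::euclidean_space \<Rightarrow> real"
  assumes f: "integrable lborel f" and g: "integrable lborel g"
  shows "integrable (lborel \<Otimes>\<^sub>M lborel) (\<lambda>(x, y). f x * g y)"
proof (rule lborel_pair.Fubini_integrable)
  have [measurable]: "f \<in> borel_measurable borel" "g \<in> borel_measurable borel" using f g by auto
  show "(\<lambda>(x, y). f x * g y) \<in> borel_measurable (lborel \<Otimes>\<^sub>M lborel)" by measurable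
qed (use f g in \<open>auto simp: abs_mult\<close>)

lemma integrable_pair_mult_diff:
  fixes f g :: "'a::euclidean_space \<Rightarrow> real"
  assumes f: "integrable lborel f" and g: "integrable lborel g"
  shows "integrable (lborel \<Otimes>\<^sub>M lborel) (\<lambda>(x, y). f x * g (y - x))"
proof (rule lborel_pair.Fubini_integrable)
  have [measurable]: "f \<in> borel_measurable borel" "g \<in> borel_measurable borel" using f g by auto
  show "(\<lambda>(x, y). f x * g (y - x)) \<in> borel_measurable (lborel \<Otimes>\<^sub>M lborel)" by measurable
  have i: "integrable lborel (\<lambda>y. g (y - x))" for x
    using integrable_lborel_translate[OF g, of "- x"] by simp
  have "(\<integral>y. \<bar>g (y - x)\<bar> \<partial>lborel) = (\<integral>y. \<bar>g y\<bar> \<partial>lborel)" for x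
    using integral_lborel_translate[of "\<lambda>y. \<bar>g y\<bar>" "- x"] by simp
  then show "integrable lborel (\<lambda>x. \<integral>y. norm (case (x, y) of (x, y) \<Rightarrow> f x * g (y - x)) \<partial>lborel)"
    using f by (simp add: abs_mult)
  show "AE x in lborel. integrable lborel (\<lambda>y. case (x, y) of (x, y) \<Rightarrow> f x * g (y - x))"
    using i by simp
qed

section \<open>Integrable weights and Schur's test\<close>

text \<open>With the full dimension as exponent, the weight is dominated by a product of the one-variable functions \<open>1 / (1 + r\<^sup>2)\<close>.\<close>

definition decay :: "'a::euclidean_space \<Rightarrow> real" where
  "decay x = 1 / (1 + (norm x)\<^sup>2) ^ DIM('a)"

lemma decay_pos: "decay x > 0"
  unfolding decay_def by (intro divide_pos_pos zero_less_power add_pos_nonneg) auto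

lemma decay_nonneg [simp]: "decay x \<ge> 0"
  using decay_pos[of x] by simp

lemma decay_le_1: "decay x \<le> 1"
  unfolding decay_def by (subst divide_le_eq_1_pos) (auto intro!: zero_less_power add_pos_nonneg one_le_power)

lemma decay_minus [simp]: "decay (- x) = decay x" "decay (x - y) = decay (y - x)"
  by (simp_all add: decay_def norm_minus_commute)

lemma continuous_decay [continuous_intros]:
  "continuous_on S f \<Longrightarrow> continuous_on S (\<lambda>x. decay (f x))"
  unfolding decay_def by (intro continuous_intros) (auto simp: add_nonneg_eq_0_iff)

lemma measurable_decay [measurable]: "decay \<in> borel_measurable borel"
  by (intro borel_measurable_continuous_onI continuous_intros)

lemma nn_integral_decay_finite: "(\<integral>\<^sup>+x. ennreal (decay (x::'a::euclidean_space)) \<partial>lborel) < \<infinity>"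
proof -
  have le: "decay x \<le> (\<Prod>b\<in>Basis. 1 / (1 + (x \<bullet> b)\<^sup>2))" for x :: 'a
  proof -
    \<comment> \<open>each factor of the power is compared with the factor of one coordinate\<close>
    have "(\<Prod>b\<in>(Basis::'a set). 1 / (1 + (norm x)\<^sup>2)) \<le> (\<Prod>b\<in>Basis. 1 / (1 + (x \<bullet> b)\<^sup>2))"
    proof (intro prod_mono conjI)
      fix b :: 'a assume b: "b \<in> Basis"
      have "(x \<bullet> b)\<^sup>2 \<le> (norm x)\<^sup>2"
        using Basis_le_norm[OF b, of x] by (simp add: abs_le_square_iff[symmetric])
      then show "1 / (1 + (norm x)\<^sup>2) \<le> 1 / (1 + (x \<bullet> b)\<^sup>2)"
        by (intro divide_left_mono mult_pos_pos add_pos_nonneg) auto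
    qed auto
    then show ?thesis by (simp add: decay_def power_divide)
  qed
  have "(\<integral>\<^sup>+x. ennreal (decay (x::'a)) \<partial>lborel)
      \<le> (\<integral>\<^sup>+x. (\<Prod>b\<in>(Basis::'a set). ennreal (1 / (1 + (x \<bullet> b)\<^sup>2))) \<partial>lborel)"
    by (intro nn_integral_mono) (auto simp: prod_ennreal intro!: ennreal_leI le)
  also have "\<dots> = (\<Prod>b\<in>(Basis::'a set). (\<integral>\<^sup>+r. ennreal (1 / (1 + r\<^sup>2)) \<partial>lborel))"
    by (rule nn_integral_lborel_prod) auto
  also have "\<dots> < \<infinity>"
  proof -
    have "(\<integral>\<^sup>+r. ennreal (1 / (1 + r\<^sup>2)) \<partial>lborel) < \<infinity>"
      using integrable_inverse_1_plus_square
      by (auto simp: set_integrable_def integrable_iff_bounded inverse_eq_divide abs_of_nonneg)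
    then show ?thesis
      by (simp add: power_less_top_ennreal)
  qed
  finally show ?thesis .
qed

lemma integrable_decay: "integrable lborel (decay :: 'a::euclidean_space \<Rightarrow> real)"
  using nn_integral_decay_finite by (intro integrableI_nonneg) auto

lemma integrable_decay_diff [simp]:
  "integrable lborel (\<lambda>y. decay (x - y :: 'a::euclidean_space))"
  "integrable lborel (\<lambda>y. decay (y - x :: 'a::euclidean_space))"
  using integrable_lborel_affine[OF integrable_decay, of "-1" x]
    integrable_lborel_affine[OF integrable_decay, of 1 "- x"] by simp_all

lemma integral_decay_diff:
  "(\<integral>y. decay (x - y :: 'a::euclidean_space) \<partial>lborel) = integral\<^sup>L lborel (decay :: 'a \<Rightarrow> real)"
  using integral_lborel_affine[of "-1" "decay :: 'a \<Rightarrow> real" x] by (simp)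

lemma nn_integral_decay_diff:
  "(\<integral>\<^sup>+y. ennreal (decay (x - y :: 'a::euclidean_space)) \<partial>lborel) = ennreal (integral\<^sup>L lborel (decay :: 'a \<Rightarrow> real))"
  "(\<integral>\<^sup>+y. ennreal (decay (y - x :: 'a::euclidean_space)) \<partial>lborel) = ennreal (integral\<^sup>L lborel (decay :: 'a \<Rightarrow> real))"
  using integral_decay_diff[of x] by (auto simp: nn_integral_eq_integral)

lemma power_times_exp_bounded:
  fixes d :: real
  assumes "d > 0"
  shows "\<exists>C. \<forall>y\<ge>0. y ^ k * exp (- d * y) \<le> C"
proof -
  have "((\<lambda>y. y ^ k * exp (- d * y)) \<longlongrightarrow> 0) at_top"
    using assms by real_asymp
  then have "eventually (\<lambda>y. y ^ k * exp (- d * y) < 1) at_top"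
    by (rule order_tendstoD) simp
  then obtain b where b: "\<And>y. y \<ge> b \<Longrightarrow> y ^ k * exp (- d * y) < 1"
    by (auto simp: eventually_at_top_linorder)
  have "compact ((\<lambda>y. y ^ k * exp (- d * y)) ` {0..b})"
    by (intro compact_continuous_image continuous_intros compact_Icc)
  then obtain C where C: "\<And>y. y \<in> {0..b} \<Longrightarrow> norm (y ^ k * exp (- d * y)) \<le> C"
    by (meson bounded_iff compact_imp_bounded imageI)
  show ?thesis
  proof (intro exI[of _ "max C 1"] allI impI)
    fix y :: real assume "y \<ge> 0"
    then show "y ^ k * exp (- d * y) \<le> max C 1"
      using b[of y] C[of y] by (cases "y \<le> b") (auto simp: le_max_iff_disj)
  qed
qed

text \<open>In the variable \<open>y = 1 + |x|\<^sup>2\<close> this is the boundedness of a power of \<open>y\<close> times \<open>e\<^bsup>-d y\<^esup>\<close>.\<close>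

lemma gaussian_le_decay:
  fixes d :: real
  assumes "d > 0"
  shows "\<exists>C\<ge>0. \<forall>x::'a::euclidean_space. norm x ^ k * exp (- d * (norm x)\<^sup>2) \<le> C * decay x"
proof -
  obtain C where C: "\<And>y. y \<ge> 0 \<Longrightarrow> y ^ (k + DIM('a)) * exp (- d * y) \<le> C"
    using power_times_exp_bounded[OF assms] by blast
  have "norm x ^ k * exp (- d * (norm x)\<^sup>2) \<le> C * exp d * decay x" for x :: 'a
  proof -
    let ?y = "1 + (norm x)\<^sup>2"
    have y: "?y > 0" by (intro add_pos_nonneg) auto
    have "norm x \<le> ?y"
    proof (cases "norm x \<le> 1")
      case True then show ?thesis by (simp add: add_increasing2)
    next
      case False then have "norm x \<le> (norm x)\<^sup>2" by (intro self_le_power) auto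
      then show ?thesis by simp
    qed
    then have "norm x ^ k * exp (- d * (norm x)\<^sup>2) \<le> ?y ^ k * exp (- d * (norm x)\<^sup>2)"
      by (intro mult_right_mono power_mono) auto
    also have "\<dots> = (?y ^ (k + DIM('a)) * exp (- d * ?y)) * exp d * decay x"
      using y by (simp add: decay_def power_add field_simps exp_minus flip: exp_add)
    also have "\<dots> \<le> C * exp d * decay x"
      using C[of ?y] y by (intro mult_right_mono) auto
    finally show ?thesis .
  qed
  moreover have "0 \<le> C * exp d" using order_trans[OF _ C[of 0], of 0] by simp
  ultimately show ?thesis by blast
qed

lemma integrable_gaussian:
  fixes d :: real
  assumes "d > 0"
  shows "integrable lborel (\<lambda>x::'a::euclidean_space. exp (- d * (norm x)\<^sup>2))"
proof -
  obtain C where C: "C \<ge> 0" "\<And>x::'a. norm x ^ 0 * exp (- d * (norm x)\<^sup>2) \<le> C * decay x"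
    using gaussian_le_decay[OF assms] by blast
  show ?thesis
    by (rule Bochner_Integration.integrable_bound[of _ "\<lambda>x. C * decay x"])
       (use C integrable_decay in auto)
qed

text \<open>Cauchy--Schwarz with the measure \<open>decay (x - z) dz\<close> bounds \<open>|g(x)|\<^sup>2\<close> by
  \<open>K\<^sup>2 \<integral>decay\<close> times the convolution of \<open>decay\<close> with \<open>|f|\<^sup>2\<close>; Tonelli then gives Young's inequality for
  \<open>L\<^sup>1 * L\<^sup>2\<close>. The integral defining \<open>g\<close> converges at every point because \<open>decay\<close>, bounded by 1, is itself
  square integrable, and this pointwise convergence is what makes the operator linear as a map of
  functions rather than of classes.\<close>

lemma schur_test:
  fixes \<kappa> :: "'a::euclidean_space \<Rightarrow> 'a \<Rightarrow> complex"
  assumes \<kappa> [measurable]: "case_prod \<kappa> \<in> borel_measurable (borel \<Otimes>\<^sub>M borel)"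
    and bound: "\<And>x z. norm (\<kappa> x z) \<le> K * decay (x - z)"
    and f [measurable]: "f \<in> borel_measurable borel"
    and f2: "integrable lborel (\<lambda>x. (norm (f x))\<^sup>2)"
  defines "g \<equiv> \<lambda>x. \<integral>z. \<kappa> x z * f z \<partial>lborel"
  shows "integrable lborel (\<lambda>z. \<kappa> x z * f z)"
    and "g \<in> borel_measurable borel"
    and "integrable lborel (\<lambda>x. (norm (g x))\<^sup>2)"
    and "(\<integral>x. (norm (g x))\<^sup>2 \<partial>lborel)
           \<le> (K * integral\<^sup>L lborel (decay :: 'a \<Rightarrow> real))\<^sup>2 * (\<integral>x. (norm (f x))\<^sup>2 \<partial>lborel)"
proof -
  let ?J = "integral\<^sup>L lborel (decay :: 'a \<Rightarrow> real)"
  have [measurable]: "(\<lambda>(x, z). \<kappa> x z) \<in> borel_measurable (borel \<Otimes>\<^sub>M borel)"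
    using \<kappa> by simp
  have [measurable]: "case_prod \<kappa> \<in> borel_measurable (borel \<Otimes>\<^sub>M lborel)"
    using \<kappa> by (simp cong: measurable_cong_sets)
  have K: "K \<ge> 0"
    using order_trans[OF norm_ge_zero bound[of 0 0]] decay_pos[of "0::'a"]
    by (simp add: zero_le_mult_iff)
  have J: "?J \<ge> 0" by (simp add: integral_nonneg_AE)
  show int: "integrable lborel (\<lambda>z. \<kappa> x z * f z)" for x
  proof (rule Bochner_Integration.integrable_bound)
    show "integrable lborel (\<lambda>z. K * (decay (x - z) + (norm (f z))\<^sup>2))"
      using f2 by auto
    show "AE z in lborel. norm (\<kappa> x z * f z) \<le> norm (K * (decay (x - z) + (norm (f z))\<^sup>2))"
    proof (intro AE_I2)
      fix z
      have *: "d * n \<le> d + n\<^sup>2" if "0 \<le> d" "d \<le> 1" "0 \<le> n" for d n :: real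
      proof (cases "n \<le> 1")
        case True then have "d * n \<le> d" using that by (simp add: mult_left_le)
        then show ?thesis by (simp add: add_increasing2)
      next
        case False
        then have "d * n \<le> 1 * n" using that by (intro mult_right_mono) auto
        also have "\<dots> \<le> n\<^sup>2" using False by (simp add: power2_eq_square)
        finally show ?thesis using that by simp
      qed
      have "norm (\<kappa> x z * f z) \<le> K * decay (x - z) * norm (f z)"
        using bound[of x z] by (auto simp: norm_mult intro: mult_right_mono)
      also have "\<dots> \<le> K * (decay (x - z) + (norm (f z))\<^sup>2)"
        using *[of "decay (x - z)" "norm (f z)"] K decay_le_1[of "x - z"]
        by (simp add: mult.assoc mult_left_mono)
      finally show "norm (\<kappa> x z * f z) \<le> norm (K * (decay (x - z) + (norm (f z))\<^sup>2))" by simp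
    qed
  qed simp
  show g [measurable]: "g \<in> borel_measurable borel"
    unfolding g_def by measurable
  have nn: "ennreal ((norm (g x))\<^sup>2)
     \<le> ennreal (K\<^sup>2 * ?J) * (\<integral>\<^sup>+z. ennreal (decay (x - z) * (norm (f z))\<^sup>2) \<partial>lborel)" for x
  proof -
    let ?F = "\<lambda>z. ennreal (sqrt (decay (x - z)))" and ?G = "\<lambda>z. ennreal (sqrt (decay (x - z)) * norm (f z))"
    have sq: "(?F z)\<^sup>2 = ennreal (decay (x - z))"
      "(?G z)\<^sup>2 = ennreal (decay (x - z) * (norm (f z))\<^sup>2)" for z
      by (simp_all add: power_mult_distrib ennreal_power)
    have FG: "?F z * ?G z = ennreal (decay (x - z) * norm (f z))" for z
      by (simp add: ennreal_mult[symmetric] mult.assoc[symmetric])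
    have "ennreal (norm (g x)) \<le> (\<integral>\<^sup>+z. ennreal (norm (\<kappa> x z * f z)) \<partial>lborel)"
      unfolding g_def by (rule integral_norm_bound_ennreal[OF int])
    also have "\<dots> \<le> (\<integral>\<^sup>+z. ennreal K * (?F z * ?G z) \<partial>lborel)"
      unfolding FG using bound[of x] K
      by (intro nn_integral_mono)
        (auto simp: norm_mult ennreal_mult[symmetric] mult.assoc[symmetric] intro!: ennreal_leI mult_right_mono)
    also have "\<dots> = ennreal K * (\<integral>\<^sup>+z. ?F z * ?G z \<partial>lborel)"
      by (rule nn_integral_cmult) measurable
    finally have "(ennreal (norm (g x)))\<^sup>2 \<le> (ennreal K * (\<integral>\<^sup>+z. ?F z * ?G z \<partial>lborel))\<^sup>2"
      by (intro power_mono) auto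
    also have "\<dots> \<le> ennreal (K\<^sup>2) * ((\<integral>\<^sup>+z. (?F z)\<^sup>2 \<partial>lborel) * (\<integral>\<^sup>+z. (?G z)\<^sup>2 \<partial>lborel))"
      unfolding power_mult_distrib using K
      by (intro mult_mono Cauchy_Schwarz_nn_integral) (auto simp: ennreal_power)
    also have "\<dots> = ennreal (K\<^sup>2 * ?J) * (\<integral>\<^sup>+z. ennreal (decay (x - z) * (norm (f z))\<^sup>2) \<partial>lborel)"
      unfolding sq nn_integral_decay_diff using J by (simp add: ennreal_mult mult.assoc)
    finally show ?thesis by (simp add: ennreal_power)
  qed
  have fin: "(\<integral>\<^sup>+x. ennreal ((norm (f x))\<^sup>2) \<partial>lborel) = ennreal (\<integral>x. (norm (f x))\<^sup>2 \<partial>lborel)"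
    using f2 by (intro nn_integral_eq_integral) auto
  have "(\<integral>\<^sup>+x. ennreal ((norm (g x))\<^sup>2) \<partial>lborel)
     \<le> (\<integral>\<^sup>+x. ennreal (K\<^sup>2 * ?J) * (\<integral>\<^sup>+z. ennreal (decay (x - z) * (norm (f z))\<^sup>2) \<partial>lborel) \<partial>lborel)"
    by (intro nn_integral_mono nn)
  also have "\<dots> = ennreal (K\<^sup>2 * ?J) * (\<integral>\<^sup>+x. (\<integral>\<^sup>+z. ennreal (decay (x - z) * (norm (f z))\<^sup>2) \<partial>lborel) \<partial>lborel)"
    by (rule nn_integral_cmult) measurable
  also have "(\<integral>\<^sup>+x. (\<integral>\<^sup>+z. ennreal (decay (x - z) * (norm (f z))\<^sup>2) \<partial>lborel) \<partial>lborel)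
     = (\<integral>\<^sup>+z. (\<integral>\<^sup>+x. ennreal (decay (x - z) * (norm (f z))\<^sup>2) \<partial>lborel) \<partial>lborel)"
    by (rule lborel_pair.Fubini') (measurable)
  also have "\<dots> = (\<integral>\<^sup>+z. ennreal ?J * ennreal ((norm (f z))\<^sup>2) \<partial>lborel)"
    by (intro nn_integral_cong) (simp add: ennreal_mult nn_integral_multc nn_integral_decay_diff)
  also have "\<dots> = ennreal ?J * ennreal (\<integral>x. (norm (f x))\<^sup>2 \<partial>lborel)"
    by (subst nn_integral_cmult) (auto simp: fin)
  also have "ennreal (K\<^sup>2 * ?J) * (ennreal ?J * ennreal (\<integral>x. (norm (f x))\<^sup>2 \<partial>lborel))
      = ennreal ((K * ?J)\<^sup>2 * (\<integral>x. (norm (f x))\<^sup>2 \<partial>lborel))"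
    using J K by (simp add: ennreal_mult[symmetric] integral_nonneg_AE power2_eq_square mult_ac)
  finally have main: "(\<integral>\<^sup>+x. ennreal ((norm (g x))\<^sup>2) \<partial>lborel)
       \<le> ennreal ((K * ?J)\<^sup>2 * (\<integral>x. (norm (f x))\<^sup>2 \<partial>lborel))" .
  show ig: "integrable lborel (\<lambda>x. (norm (g x))\<^sup>2)"
    using main by (intro integrableI_nonneg) (auto intro: le_less_trans)
  show "(\<integral>x. (norm (g x))\<^sup>2 \<partial>lborel) \<le> (K * ?J)\<^sup>2 * (\<integral>x. (norm (f x))\<^sup>2 \<partial>lborel)"
    using main ig by (subst (asm) nn_integral_eq_integral) (auto simp: integral_nonneg_AE)
qed

section \<open>Invariance of Lebesgue measure under isometries\<close>

text \<open>The uniqueness argument for Haar measure: with \<open>g = decay\<close>, the double integral of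
  \<open>\<phi>(R x) g(y + R x)\<close> over \<open>x\<close> and \<open>y\<close> is \<open>\<integral>(\<phi> \<circ> R) \<integral>g\<close> when \<open>y\<close> is integrated first. Translating \<open>x\<close> by
  \<open>R\<^sup>-\<^sup>1 y\<close> turns the integrand into \<open>\<phi>(R x - y) g(R x)\<close>, whose double integral is \<open>\<integral>\<phi> \<integral>(g \<circ> R)\<close>. Since \<open>g\<close> depends on the norm
  only, \<open>g \<circ> R = g\<close>, and the common factor \<open>\<integral>g\<close> cancels.\<close>

lemma nn_integral_lborel_isometry:
  fixes R :: "'a::euclidean_space \<Rightarrow> 'a" and \<phi> :: "'a \<Rightarrow> ennreal"
  assumes R: "linear R" and iso: "\<And>x. norm (R x) = norm x"
    and [measurable]: "\<phi> \<in> borel_measurable borel"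
  shows "(\<integral>\<^sup>+x. \<phi> (R x) \<partial>lborel) = (\<integral>\<^sup>+x. \<phi> x \<partial>lborel)"
proof -
  have [measurable]: "R \<in> borel_measurable borel"
    using R by (intro borel_measurable_continuous_onI linear_continuous_on linear_conv_bounded_linear[THEN iffD1])
  have "inj R"
    using R iso by (metis linear_injective_0 norm_eq_zero)
  then have surj: "surj R" using R linear_injective_imp_surjective by blast
  let ?g = "\<lambda>x::'a. ennreal (decay x)"
  let ?G = "\<integral>\<^sup>+x. ?g x \<partial>lborel"
  have gR: "decay (R x) = decay x" for x by (simp add: decay_def iso)
  have G: "?G \<noteq> 0" "?G \<noteq> \<infinity>"
  proof -
    show "?G \<noteq> \<infinity>" using nn_integral_decay_finite[where 'a='a] by simp
    have "\<not> (AE x in lborel. ?g x = 0)"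
    proof
      assume "AE x in lborel. ?g x = 0"
      then have "AE x in (lborel :: 'a measure). False"
        by eventually_elim (metis decay_pos ennreal_eq_0_iff not_le)
      then show False by (simp add: AE_iff_measurable[of UNIV])
    qed
    then show "?G \<noteq> 0" by (subst nn_integral_0_iff_AE) auto
  qed
  have "(\<integral>\<^sup>+x. \<phi> (R x) \<partial>lborel) * ?G = (\<integral>\<^sup>+x. (\<integral>\<^sup>+y. \<phi> (R x) * ?g (y + R x) \<partial>lborel) \<partial>lborel)"
  proof -
    have "(\<integral>\<^sup>+y. \<phi> (R x) * ?g (y + R x) \<partial>lborel) = \<phi> (R x) * ?G" for x
      by (subst nn_integral_cmult) (auto simp: nn_integral_lborel_translate[of ?g "R x"] add.commute)
    then show ?thesis by (simp add: nn_integral_multc)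
  qed
  also have "\<dots> = (\<integral>\<^sup>+y. (\<integral>\<^sup>+x. \<phi> (R x) * ?g (y + R x) \<partial>lborel) \<partial>lborel)"
    by (rule lborel_pair.Fubini') measurable
  also have "\<dots> = (\<integral>\<^sup>+y. (\<integral>\<^sup>+x. \<phi> (R x - y) * ?g x \<partial>lborel) \<partial>lborel)"
  proof (rule nn_integral_cong)
    fix y
    obtain w where w: "y = R w" using surj by auto
    show "(\<integral>\<^sup>+x. \<phi> (R x) * ?g (y + R x) \<partial>lborel) = (\<integral>\<^sup>+x. \<phi> (R x - y) * ?g x \<partial>lborel)"
      by (subst nn_integral_lborel_translate[of _ "-w"])
         (auto simp: w gR linear_add[OF R] linear_neg[OF R] linear_diff[OF R] algebra_simps)
  qed
  also have "\<dots> = (\<integral>\<^sup>+x. (\<integral>\<^sup>+y. \<phi> (R x - y) * ?g x \<partial>lborel) \<partial>lborel)"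
    by (rule lborel_pair.Fubini') measurable
  also have "\<dots> = (\<integral>\<^sup>+x. (\<integral>\<^sup>+y. \<phi> y \<partial>lborel) * ?g x \<partial>lborel)"
  proof (rule nn_integral_cong)
    fix x
    have "(\<integral>\<^sup>+y. \<phi> y \<partial>lborel) = (\<integral>\<^sup>+y. \<phi> (R x - y) \<partial>lborel)"
      using nn_integral_lborel_affine[of \<phi> "-1" "R x"] by simp
    then show "(\<integral>\<^sup>+y. \<phi> (R x - y) * ?g x \<partial>lborel) = (\<integral>\<^sup>+y. \<phi> y \<partial>lborel) * ?g x"
      by (simp add: nn_integral_multc)
  qed
  also have "\<dots> = (\<integral>\<^sup>+y. \<phi> y \<partial>lborel) * ?G"
    by (rule nn_integral_cmult) measurable
  finally show ?thesis using G by (simp add: ennreal_mult_cancel_left mult.commute[of _ ?G])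
qed

lemma distr_lborel_isometry:
  fixes R :: "'a::euclidean_space \<Rightarrow> 'a"
  assumes R: "linear R" and iso: "\<And>x. norm (R x) = norm x"
  shows "distr lborel borel R = lborel"
proof (rule measure_eqI)
  have [measurable]: "R \<in> borel_measurable borel"
    using R by (intro borel_measurable_continuous_onI linear_continuous_on linear_conv_bounded_linear[THEN iffD1])
  fix A assume "A \<in> sets (distr lborel borel R)"
  then have A [measurable]: "A \<in> sets borel" by simp
  have "emeasure (distr lborel borel R) A = (\<integral>\<^sup>+x. indicator A x \<partial>distr lborel borel R)"
    using A by (subst nn_integral_indicator) auto
  also have "\<dots> = (\<integral>\<^sup>+x. indicator A (R x) \<partial>lborel)"
    by (subst nn_integral_distr) auto
  also have "\<dots> = (\<integral>\<^sup>+x. indicator A x \<partial>lborel)"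
    by (rule nn_integral_lborel_isometry[OF assms]) auto
  finally show "emeasure (distr lborel borel R) A = emeasure lborel A" by simp
qed simp

lemma integral_lborel_isometry:
  fixes R :: "'a::euclidean_space \<Rightarrow> 'a" and f :: "'a \<Rightarrow> 'b::{banach, second_countable_topology}"
  assumes R: "linear R" and iso: "\<And>x. norm (R x) = norm x"
    and f: "f \<in> borel_measurable borel"
  shows "(\<integral>x. f (R x) \<partial>lborel) = (\<integral>x. f x \<partial>lborel)"
proof -
  have "R \<in> borel_measurable borel"
    using R by (intro borel_measurable_continuous_onI linear_continuous_on linear_conv_bounded_linear[THEN iffD1])
  then have "(\<integral>x. f (R x) \<partial>lborel) = (\<integral>x. f x \<partial>distr lborel borel R)"
    using f by (subst integral_distr) auto
  then show ?thesis by (simp add: distr_lborel_isometry[OF R iso])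
qed

section \<open>Decay of oscillatory integrals\<close>

lemma line_derivative_shift:
  fixes F :: "'a::real_normed_vector \<Rightarrow> 'b::real_normed_vector"
  assumes "((\<lambda>r. F (t + r0 *\<^sub>R e + r *\<^sub>R e)) has_vector_derivative D) (at 0)"
  shows "((\<lambda>r. F (t + r *\<^sub>R e)) has_vector_derivative D) (at r0)"
proof -
  have "((\<lambda>r. F (t + r0 *\<^sub>R e + r *\<^sub>R e)) \<circ> (\<lambda>r. r - r0) has_vector_derivative 1 *\<^sub>R D) (at r0)"
    by (intro vector_diff_chain_at) (auto intro!: derivative_eq_intros assms)
  then show ?thesis
    by (simp add: o_def algebra_simps flip: scaleR_add_left)
qed

text \<open>Integrating \<open>F(t + e) - F(t) = \<integral>\<^sub>0\<^sup>1 F'(t + r e) dr\<close> over \<open>t\<close>, the left side vanishes and, by Fubini and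
  translation invariance, the right side is \<open>\<integral>F'\<close>.\<close>

lemma integral_line_derivative_eq_0:
  fixes F :: "'a::euclidean_space \<Rightarrow> complex"
  assumes d: "\<And>t. ((\<lambda>r. F (t + r *\<^sub>R e)) has_vector_derivative F' t) (at 0)"
    and F: "integrable lborel F" and F': "integrable lborel F'" and cont: "continuous_on UNIV F'"
  shows "(\<integral>t. F' t \<partial>lborel) = 0"
proof -
  have [measurable]: "F' \<in> borel_measurable borel"
    using cont by (rule borel_measurable_continuous_onI)
  have ftc: "(\<integral>r. indicator {0..1} r *\<^sub>R F' (t + r *\<^sub>R e) \<partial>lborel) = F (t + e) - F t" for t
  proof -
    have "((\<lambda>r. F (t + r *\<^sub>R e)) has_vector_derivative F' (t + r *\<^sub>R e)) (at r within {0..1})" for r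
      by (rule has_vector_derivative_at_within[OF line_derivative_shift[OF d]])
    moreover have "continuous_on {0..1} (\<lambda>r. F' (t + r *\<^sub>R e))"
      by (intro continuous_on_compose2[OF cont] continuous_intros) auto
    ultimately show ?thesis
      using integral_FTC_Icc[of 0 1 "\<lambda>r. F (t + r *\<^sub>R e)" "\<lambda>r. F' (t + r *\<^sub>R e)"] by simp
  qed
  have tr: "integrable lborel (\<lambda>t. F' (t + v))" "(\<integral>t. F' (t + v) \<partial>lborel) = (\<integral>t. F' t \<partial>lborel)"
    "integrable lborel (\<lambda>t. F (t + v))" "(\<integral>t. F (t + v) \<partial>lborel) = (\<integral>t. F t \<partial>lborel)"
    "(\<integral>t. norm (F' (t + v)) \<partial>lborel) = (\<integral>t. norm (F' t) \<partial>lborel)" for v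
    using integrable_lborel_translate[OF F', of v] integral_lborel_translate[of F' v]
      integrable_lborel_translate[OF F, of v] integral_lborel_translate[of F v]
      integral_lborel_translate[of "\<lambda>t. norm (F' t)" v]
    by (simp_all add: add.commute)
  have int: "integrable (lborel \<Otimes>\<^sub>M lborel) (\<lambda>(r::real, t). indicator {0..1} r *\<^sub>R F' (t + r *\<^sub>R e))"
  proof (rule lborel_pair.Fubini_integrable)
    show "(\<lambda>(r::real, t). indicator {0..1} r *\<^sub>R F' (t + r *\<^sub>R e)) \<in> borel_measurable (lborel \<Otimes>\<^sub>M lborel)"
      by measurable
    show "integrable lborel (\<lambda>r::real. \<integral>t. norm (case (r, t) of (r, t) \<Rightarrow> indicator {0..1} r *\<^sub>R F' (t + r *\<^sub>R e)) \<partial>lborel)"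
      by (simp add: tr)
    show "AE r::real in lborel. integrable lborel (\<lambda>t. case (r, t) of (r, t) \<Rightarrow> indicator {0..1} r *\<^sub>R F' (t + r *\<^sub>R e))"
      by (simp add: tr)
  qed
  have "(\<integral>t. (\<integral>r. indicator {0..1} r *\<^sub>R F' (t + r *\<^sub>R e) \<partial>lborel) \<partial>lborel)
      = (\<integral>r. (\<integral>t. indicator {0..1} r *\<^sub>R F' (t + r *\<^sub>R e) \<partial>lborel) \<partial>lborel)"
    by (rule lborel_pair.Fubini_integral[OF int])
  also have "\<dots> = (\<integral>t. F' t \<partial>lborel)"
    by (simp add: tr)
  finally show ?thesis unfolding ftc using tr[of e] F by simp
qed

text \<open>The derivatives in the direction \<open>e\<close> up to order \<open>N\<close> exist and are bounded by multiples of \<open>w\<close>, with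
  constants that are uniform over the family indexed by \<open>I\<close>. Uniformity over the family is what
  eventually gives estimates independent of \<open>h\<close> and of the base point.\<close>

fun bounded_line_derivs ::
  "'a::euclidean_space \<Rightarrow> ('a \<Rightarrow> real) \<Rightarrow> 'i set \<Rightarrow> nat \<Rightarrow> ('i \<Rightarrow> 'a \<Rightarrow> complex) \<Rightarrow> bool" where
  "bounded_line_derivs e w I 0 f \<longleftrightarrow>
     (\<exists>C. \<forall>i\<in>I. \<forall>t. norm (f i t) \<le> C * w t) \<and> (\<forall>i\<in>I. continuous_on UNIV (f i))"
| "bounded_line_derivs e w I (Suc N) f \<longleftrightarrow>
     (\<exists>C. \<forall>i\<in>I. \<forall>t. norm (f i t) \<le> C * w t) \<and> (\<forall>i\<in>I. continuous_on UNIV (f i)) \<and>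
     (\<exists>f'. (\<forall>i\<in>I. \<forall>t. ((\<lambda>r. f i (t + r *\<^sub>R e)) has_vector_derivative f' i t) (at 0)) \<and>
           bounded_line_derivs e w I N f')"

lemma bounded_line_derivs_0:
  "bounded_line_derivs e w I N f \<Longrightarrow> bounded_line_derivs e w I 0 f"
  by (cases N) auto

lemma bounded_line_derivs_SucI:
  assumes "bounded_line_derivs e w I 0 f" "bounded_line_derivs e w I N f'"
    and "\<And>i t. i \<in> I \<Longrightarrow> ((\<lambda>r. f i (t + r *\<^sub>R e)) has_vector_derivative f' i t) (at 0)"
  shows "bounded_line_derivs e w I (Suc N) f"
  using assms by auto

lemma bounded_line_derivs_Suc:
  "bounded_line_derivs e w I (Suc N) f \<Longrightarrow> bounded_line_derivs e w I N f"
proof (induction N arbitrary: f)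
  case 0
  then show ?case by (rule bounded_line_derivs_0)
next
  case (Suc N)
  then obtain f' where
    "\<forall>i\<in>I. \<forall>t. ((\<lambda>r. f i (t + r *\<^sub>R e)) has_vector_derivative f' i t) (at 0)"
    "bounded_line_derivs e w I (Suc N) f'"
    unfolding bounded_line_derivs.simps(2)[of e w I "Suc N"] by blast
  with Suc show ?case by (intro bounded_line_derivs_SucI[of e w I f N f'] bounded_line_derivs_0[of e w I "Suc (Suc N)"]) auto
qed

lemma bounded_line_derivs_add:
  fixes f g :: "'i \<Rightarrow> 'a::euclidean_space \<Rightarrow> complex"
  assumes "bounded_line_derivs e w I N f" "bounded_line_derivs e w I N g"
  shows "bounded_line_derivs e w I N (\<lambda>i t. f i t + g i t)"
proof -
  have base: "bounded_line_derivs e w I 0 (\<lambda>i t. f i t + g i t)"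
    if "bounded_line_derivs e w I 0 f" "bounded_line_derivs e w I 0 g" for f g :: "'i \<Rightarrow> 'a \<Rightarrow> complex"
  proof -
    from that obtain C D where "\<forall>i\<in>I. \<forall>t. norm (f i t) \<le> C * w t" "\<forall>i\<in>I. \<forall>t. norm (g i t) \<le> D * w t"
      by auto
    then have "\<forall>i\<in>I. \<forall>t. norm (f i t + g i t) \<le> (C + D) * w t"
      by (auto simp: distrib_right intro!: norm_triangle_mono)
    then show ?thesis using that by (auto intro!: continuous_intros)
  qed
  show ?thesis using assms
  proof (induction N arbitrary: f g)
    case 0
    then show ?case by (rule base)
  next
    case (Suc N)
    from Suc.prems obtain f' g' where
      "\<forall>i\<in>I. \<forall>t. ((\<lambda>r. f i (t + r *\<^sub>R e)) has_vector_derivative f' i t) (at 0)" "bounded_line_derivs e w I N f'"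
      "\<forall>i\<in>I. \<forall>t. ((\<lambda>r. g i (t + r *\<^sub>R e)) has_vector_derivative g' i t) (at 0)" "bounded_line_derivs e w I N g'"
      by auto
    then have "\<And>i t. i \<in> I \<Longrightarrow> ((\<lambda>r. f i (t + r *\<^sub>R e) + g i (t + r *\<^sub>R e)) has_vector_derivative f' i t + g' i t) (at 0)"
      "bounded_line_derivs e w I N (\<lambda>i t. f' i t + g' i t)"
      by (auto intro!: has_vector_derivative_add Suc.IH)
    moreover have "bounded_line_derivs e w I 0 (\<lambda>i t. f i t + g i t)"
      using Suc.prems by (intro base bounded_line_derivs_0)
    ultimately show ?case by (intro bounded_line_derivs_SucI)
  qed
qed

lemma bounded_line_derivs_mult:
  fixes f g :: "'i \<Rightarrow> 'a::euclidean_space \<Rightarrow> complex"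
  assumes "bounded_line_derivs e v I N f" "bounded_line_derivs e w I N g"
  shows "bounded_line_derivs e (\<lambda>t. v t * w t) I N (\<lambda>i t. f i t * g i t)"
proof -
  have base: "bounded_line_derivs e (\<lambda>t. v t * w t) I 0 (\<lambda>i t. f i t * g i t)"
    if "bounded_line_derivs e v I 0 f" "bounded_line_derivs e w I 0 g" for f g :: "'i \<Rightarrow> 'a \<Rightarrow> complex"
  proof -
    from that obtain C D where CD: "\<forall>i\<in>I. \<forall>t. norm (f i t) \<le> C * v t" "\<forall>i\<in>I. \<forall>t. norm (g i t) \<le> D * w t"
      by auto
    have "norm (f i t * g i t) \<le> (C * D) * (v t * w t)" if "i \<in> I" for i t
    proof -
      have "norm (f i t) * norm (g i t) \<le> (C * v t) * (D * w t)"
        using CD that order_trans[OF norm_ge_zero CD(1)[rule_format, OF that, of t]] by (intro mult_mono) auto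
      then show ?thesis by (simp add: norm_mult mult_ac)
    qed
    then show ?thesis using that by (auto intro!: continuous_intros)
  qed
  show ?thesis using assms
  proof (induction N arbitrary: f g)
    case 0
    then show ?case by (rule base)
  next
    case (Suc N)
    from Suc.prems obtain f' g' where *:
      "\<forall>i\<in>I. \<forall>t. ((\<lambda>r. f i (t + r *\<^sub>R e)) has_vector_derivative f' i t) (at 0)" "bounded_line_derivs e v I N f'"
      "\<forall>i\<in>I. \<forall>t. ((\<lambda>r. g i (t + r *\<^sub>R e)) has_vector_derivative g' i t) (at 0)" "bounded_line_derivs e w I N g'"
      by auto
    have "((\<lambda>r. f i (t + r *\<^sub>R e) * g i (t + r *\<^sub>R e)) has_vector_derivative f i t * g' i t + f' i t * g i t) (at 0)"
      if "i \<in> I" for i t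
      using has_vector_derivative_mult[OF *(1)[rule_format, OF that, of t] *(3)[rule_format, OF that, of t]] by simp
    moreover have "bounded_line_derivs e (\<lambda>t. v t * w t) I N (\<lambda>i t. f i t * g' i t + f' i t * g i t)"
      using * Suc.prems[THEN bounded_line_derivs_Suc] by (intro bounded_line_derivs_add Suc.IH)
    moreover have "bounded_line_derivs e (\<lambda>t. v t * w t) I 0 (\<lambda>i t. f i t * g i t)"
      using Suc.prems by (intro base bounded_line_derivs_0)
    ultimately show ?case by (intro bounded_line_derivs_SucI)
  qed
qed

lemma bounded_line_derivs_const:
  "bounded_line_derivs e (\<lambda>_. 1) I N (\<lambda>i t. c)"
proof (induction N arbitrary: c)
  case 0
  show ?case by auto
next
  case (Suc N)
  have "\<exists>C. \<forall>i\<in>I. \<forall>t. norm c \<le> C * 1" by auto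
  then show ?case using Suc[of 0] by (auto intro!: exI[of _ "\<lambda>_ _. 0"])
qed

lemma bounded_line_derivs_cmult:
  "bounded_line_derivs e w I N f \<Longrightarrow> bounded_line_derivs e w I N (\<lambda>i t. c * f i t)"
  using bounded_line_derivs_mult[OF bounded_line_derivs_const[of e I N c], of w f] by simp

text \<open>Each integration by parts in the direction \<open>e\<close> moves a factor \<open>\<i> l(e)\<close> from the exponential to a
  derivative of \<open>f\<close>.\<close>

lemma fourier_integral_decay:
  fixes f :: "'i \<Rightarrow> 'a::euclidean_space \<Rightarrow> complex"
  assumes "bounded_line_derivs e w I N f" and w: "integrable lborel w"
  shows "\<exists>C. \<forall>i\<in>I. \<forall>l. linear l \<longrightarrow> \<bar>l e\<bar> ^ N * norm (\<integral>t. cis (l t) * f i t \<partial>lborel) \<le> C"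
proof -
  have int: "integrable lborel (\<lambda>t. cis (l t) * f i t)"
    if f: "continuous_on UNIV (f i)" and l: "linear l"
      and C: "\<forall>t. norm (f i t) \<le> C * w t" for C i l and f :: "'i \<Rightarrow> 'a \<Rightarrow> complex"
  proof (rule Bochner_Integration.integrable_bound)
    show "integrable lborel (\<lambda>t. C * w t)" using w by simp
    have [measurable]: "l \<in> borel_measurable borel" "f i \<in> borel_measurable borel"
      using l f by (auto intro!: borel_measurable_continuous_onI linear_continuous_on linear_conv_bounded_linear[THEN iffD1])
    show "(\<lambda>t. cis (l t) * f i t) \<in> borel_measurable lborel"
      unfolding cis_conv_exp by measurable
    show "AE t in lborel. norm (cis (l t) * f i t) \<le> norm (C * w t)"
      using C by (auto simp: norm_mult intro: order_trans[OF _ abs_ge_self])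
  qed
  show ?thesis using assms(1)
  proof (induction N arbitrary: f)
    case 0
    then obtain C where C: "\<forall>i\<in>I. \<forall>t. norm (f i t) \<le> C * w t" and cont: "\<forall>i\<in>I. continuous_on UNIV (f i)" by auto
    have "norm (\<integral>t. cis (l t) * f i t \<partial>lborel) \<le> (\<integral>t. C * w t \<partial>lborel)" if "i \<in> I" "linear l" for i l
    proof (rule order_trans[OF integral_norm_bound integral_mono])
      show "integrable lborel (\<lambda>t. norm (cis (l t) * f i t))"
        using C cont that by (intro integrable_norm int[of f i l C]) auto
      show "integrable lborel (\<lambda>t. C * w t)" using w by simp
      show "norm (cis (l t) * f i t) \<le> C * w t" for t using C that by (simp add: norm_mult)
    qed
    then show ?case by auto
  next
    case (Suc N)
    obtain C f' where C: "\<forall>i\<in>I. \<forall>t. norm (f i t) \<le> C * w t" and cont: "\<forall>i\<in>I. continuous_on UNIV (f i)"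
      and d: "\<forall>i\<in>I. \<forall>t. ((\<lambda>r. f i (t + r *\<^sub>R e)) has_vector_derivative f' i t) (at 0)"
      and f': "bounded_line_derivs e w I N f'"
      using Suc.prems by auto
    obtain C' where C': "\<forall>i\<in>I. \<forall>t. norm (f' i t) \<le> C' * w t" and cont': "\<forall>i\<in>I. continuous_on UNIV (f' i)"
      using bounded_line_derivs_0[OF f'] by auto
    from Suc.IH[OF f'] obtain D where
      D: "\<forall>i\<in>I. \<forall>l. linear l \<longrightarrow> \<bar>l e\<bar> ^ N * norm (\<integral>t. cis (l t) * f' i t \<partial>lborel) \<le> D" by auto
    have "\<bar>l e\<bar> ^ Suc N * norm (\<integral>t. cis (l t) * f i t \<partial>lborel) \<le> D" if i: "i \<in> I" and l: "linear l" for i l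
    proof -
      have cl: "continuous_on UNIV l"
        using l by (simp add: linear_continuous_on linear_conv_bounded_linear)
      have i1: "integrable lborel (\<lambda>t. cis (l t) * f i t)" and i2: "integrable lborel (\<lambda>t. cis (l t) * f' i t)"
        by (rule int[of f i l C] int[of f' i l C']; use i l C C' cont cont' in auto)+
      let ?F' = "\<lambda>t. cis (l t) * f' i t + \<i> * l e * (cis (l t) * f i t)"
      have "(\<integral>t. ?F' t \<partial>lborel) = 0"
      proof (rule integral_line_derivative_eq_0)
        fix t
        have "((\<lambda>r. cis (l t + r * l e)) has_vector_derivative \<i> * l e * cis (l t)) (at 0)"
        proof -
          have "((\<lambda>z. exp (\<i> * (of_real (l t) + z * of_real (l e)))) has_field_derivative
                  \<i> * l e * exp (\<i> * of_real (l t))) (at (of_real 0))"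
            by (auto intro!: derivative_eq_intros)
          from has_vector_derivative_real_field[OF this] show ?thesis
            by (simp add: cis_conv_exp)
        qed
        from has_vector_derivative_mult[OF this d[rule_format, OF i, of t]]
        show "((\<lambda>r. cis (l (t + r *\<^sub>R e)) * f i (t + r *\<^sub>R e)) has_vector_derivative ?F' t) (at 0)"
          using l by (simp add: linear_add linear_scale mult_ac add_ac)
      next
        show "continuous_on UNIV ?F'"
          unfolding cis_conv_exp using cl cont[rule_format, OF i] cont'[rule_format, OF i]
          by (intro continuous_intros)
      qed (use i1 i2 in auto)
      then have "(\<integral>t. cis (l t) * f' i t \<partial>lborel) = - (\<i> * l e * (\<integral>t. cis (l t) * f i t \<partial>lborel))"
        using i1 i2 by (simp add: eq_neg_iff_add_eq_0)
      then have "norm (\<integral>t. cis (l t) * f' i t \<partial>lborel) = \<bar>l e\<bar> * norm (\<integral>t. cis (l t) * f i t \<partial>lborel)"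
        by (simp add: norm_mult)
      then show ?thesis using D[rule_format, OF i l] by (simp add: mult_ac)
    qed
    then show ?case by blast
  qed
qed

text \<open>The chain rule gives a factor \<open>s / 2\<close> per derivative. It is at most 1, so dilated symbols satisfy bounds
  uniform in \<open>0 < s \<le> 1\<close>.\<close>

lemma smooth_line_derivs:
  fixes b :: "'a::euclidean_space \<Rightarrow> complex"
  assumes b: "smooth b" and bound: "\<And>vs. vs \<in> lists Basis \<Longrightarrow> \<exists>C. \<forall>x. norm (iter_deriv vs b x) \<le> C"
    and e: "e \<in> Basis"
  shows "bounded_line_derivs e (\<lambda>_. 1) ({0<..1} \<times> UNIV) N
     (\<lambda>(s, c) t. b (s *\<^sub>R (c + (1/2) *\<^sub>R t)))"
proof -
  define g where "g k = iter_deriv (replicate k e) b" for k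
  have re: "replicate k e \<in> lists Basis" for k using e by (simp add: in_lists_conv_set)
  have diff: "g k differentiable (at x)" for k x
    using b re unfolding smooth_def g_def by blast
  then have cont: "continuous_on UNIV (g k)" for k
    by (meson continuous_at_imp_continuous_on differentiable_imp_continuous_within)
  have der: "(g k has_derivative frechet_derivative (g k) (at x)) (at x)" for k x
    using diff frechet_derivative_works by blast
  have suc: "frechet_derivative (g k) (at x) e = g (Suc k) x" for k x
    by (simp add: g_def)
  define F where "F j k = (\<lambda>(s, c) t. complex_of_real ((s/2) ^ j) * g k (s *\<^sub>R (c + (1/2) *\<^sub>R t)))"
    for j k :: nat
  \<comment> \<open>generalized over the derivatives of \<open>b\<close> and the powers of \<open>s / 2\<close>, so that the class is closed under \<open>\<partial>\<^sub>e\<close>\<close>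
  have "bounded_line_derivs e (\<lambda>_. 1) ({0<..1} \<times> UNIV) N (F j k)" for N j k
  proof (induction N arbitrary: j k)
    case 0
    obtain C where C: "\<And>x. norm (g k x) \<le> C" using bound[OF re] unfolding g_def by blast
    have "norm (F j k i t) \<le> C" if "i \<in> {0<..1} \<times> UNIV" for i t
    proof -
      obtain s c where i: "i = (s, c)" by (cases i)
      with that have s: "0 < s" "s \<le> 1" by auto
      have "(s/2) ^ j * norm (g k (s *\<^sub>R (c + (1/2) *\<^sub>R t))) \<le> 1 * C"
        using s C order_trans[OF norm_ge_zero C] by (intro mult_mono power_le_one) auto
      then show ?thesis using i s by (simp add: F_def norm_mult norm_power norm_divide)
    qed
    moreover have "continuous_on UNIV (F j k i)" for i
      by (cases i) (auto simp: F_def intro!: continuous_intros continuous_on_compose2[OF cont])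
    ultimately show ?case
      unfolding bounded_line_derivs.simps by (intro conjI exI[of _ C]) auto
  next
    case (Suc N)
    show ?case
    proof (rule bounded_line_derivs_SucI)
      show "bounded_line_derivs e (\<lambda>_. 1) ({0<..1} \<times> UNIV) N (F (Suc j) (Suc k))" by (rule Suc)
      show "bounded_line_derivs e (\<lambda>_. 1) ({0<..1} \<times> UNIV) 0 (F j k)" by (rule bounded_line_derivs_0[OF Suc])
      fix i t assume "i \<in> {0<..1::real} \<times> (UNIV :: 'a set)"
      obtain s c where i: "i = (s, c)" by (cases i)
      let ?p = "\<lambda>r. s *\<^sub>R (c + (1/2) *\<^sub>R (t + r *\<^sub>R e))"
      have p: "(?p has_derivative (\<lambda>r. (s * r / 2) *\<^sub>R e)) (at 0)"
        by (auto intro!: derivative_eq_intros simp: algebra_simps)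
      from has_derivative_compose[OF p der[of k]]
      have "((\<lambda>r. g k (?p r)) has_derivative (\<lambda>r. frechet_derivative (g k) (at (?p 0)) ((s * r / 2) *\<^sub>R e))) (at 0)" .
      moreover have "frechet_derivative (g k) (at (?p 0)) ((s * r / 2) *\<^sub>R e) = r *\<^sub>R ((s/2) *\<^sub>R g (Suc k) (?p 0))" for r
        using linear_scale[OF linear_frechet_derivative[OF diff]] by (simp add: suc)
      ultimately have "((\<lambda>r. g k (?p r)) has_vector_derivative (s/2) *\<^sub>R g (Suc k) (?p 0)) (at 0)"
        by (simp add: has_vector_derivative_def)
      then have "((\<lambda>r. complex_of_real ((s/2) ^ j) * g k (?p r)) has_vector_derivative
          complex_of_real ((s/2) ^ j) * ((s/2) *\<^sub>R g (Suc k) (?p 0))) (at 0)"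
        by (rule has_vector_derivative_mult_right)
      then show "((\<lambda>r. F j k i (t + r *\<^sub>R e)) has_vector_derivative F (Suc j) (Suc k) i t) (at 0)"
        by (simp add: F_def i scaleR_conv_of_real mult_ac)
    qed
  qed
  from this[of N 0 0] show ?thesis by (simp add: F_def g_def)
qed

section \<open>Entire functions of several variables\<close>

lemma scaleR_eq_smult: "r *\<^sub>R (x :: complex ^ 'n) = complex_of_real r *s x"
  by (simp add: vec_eq_iff scaleR_conv_of_real[where 'a=complex])

lemma norm_smult: "norm (c *s (x :: complex ^ 'n)) = norm c * norm x"
  by (simp add: norm_vec_def norm_mult L2_set_right_distrib)

lemma linear_smult: "linear (\<lambda>x :: complex ^ 'n. c *s x)"
  by (intro linearI) (simp_all add: vec_eq_iff algebra_simps)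

lemma bounded_linear_smult: "bounded_linear (\<lambda>x :: complex ^ 'n. c *s x)"
  using linear_smult linear_conv_bounded_linear by blast

lemma Hol_derivative:
  assumes "u \<in> Hol"
  obtains D where "\<And>x. (u has_derivative D x) (at x)" "\<And>x c v. D x (c *s v) = c * D x v"
  using assms unfolding Hol_def by (simp add: choice_iff) metis

lemma Hol_continuous: "u \<in> Hol \<Longrightarrow> continuous_on UNIV u"
  by (metis Hol_derivative continuous_at_imp_continuous_on has_derivative_continuous)

lemma Hol_measurable: "u \<in> Hol \<Longrightarrow> u \<in> borel_measurable borel"
  by (rule borel_measurable_continuous_onI[OF Hol_continuous])

lemma Hol_const [intro]: "(\<lambda>_. c) \<in> Hol"
  unfolding Hol_def by (auto intro!: exI[of _ "\<lambda>_. 0"] derivative_eq_intros)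

lemma Hol_add [intro]: "u \<in> Hol \<Longrightarrow> v \<in> Hol \<Longrightarrow> (\<lambda>x. u x + v x) \<in> Hol"
proof (elim Hol_derivative)
  fix D E assume "\<And>x. (u has_derivative D x) (at x)" "\<And>x c v. D x (c *s v) = c * D x v"
    "\<And>x. (v has_derivative E x) (at x)" "\<And>x c v. E x (c *s v) = c * E x v"
  then show ?thesis unfolding Hol_def
    by (auto intro!: exI[of _ "\<lambda>v. D x v + E x v" for x] derivative_eq_intros simp: algebra_simps)
qed

lemma Hol_mult [intro]: "u \<in> Hol \<Longrightarrow> v \<in> Hol \<Longrightarrow> (\<lambda>x. u x * v x) \<in> Hol"
proof (elim Hol_derivative)
  fix D E assume *: "\<And>x. (u has_derivative D x) (at x)" "\<And>x c v. D x (c *s v) = c * D x v"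
    "\<And>x. (v has_derivative E x) (at x)" "\<And>x c v. E x (c *s v) = c * E x v"
  show ?thesis unfolding Hol_def
  proof (clarify, intro exI conjI)
    fix x show "((\<lambda>x. u x * v x) has_derivative (\<lambda>h. u x * E x h + D x h * v x)) (at x)"
      using * by (auto intro!: derivative_eq_intros)
  qed (auto simp: * algebra_simps)
qed

lemma Hol_exp [intro]: "u \<in> Hol \<Longrightarrow> (\<lambda>x. exp (u x)) \<in> Hol"
proof (elim Hol_derivative)
  fix D assume *: "\<And>x. (u has_derivative D x) (at x)" "\<And>x c v. D x (c *s v) = c * D x v"
  show ?thesis unfolding Hol_def
  proof (clarify, intro exI conjI)
    fix x show "((\<lambda>x. exp (u x)) has_derivative (\<lambda>h. D x h * exp (u x))) (at x)"
      using has_derivative_compose[OF *(1) DERIV_exp[unfolded has_field_derivative_def]]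
      by (simp add: mult.commute)
  qed (auto simp: * algebra_simps)
qed

lemma Hol_affine: "u \<in> Hol \<Longrightarrow> (\<lambda>x. u (c *s x + v)) \<in> Hol"
proof (elim Hol_derivative)
  fix D assume *: "\<And>x. (u has_derivative D x) (at x)" "\<And>x c v. D x (c *s v) = c * D x v"
  show ?thesis unfolding Hol_def
  proof (clarify, intro exI conjI)
    fix x
    have "((\<lambda>x. c *s x + v) has_derivative (\<lambda>h. c *s h)) (at x)"
      using bounded_linear_imp_has_derivative[OF bounded_linear_smult[of c]] by (auto intro!: derivative_eq_intros)
    from has_derivative_compose[OF this *(1)]
    show "((\<lambda>x. u (c *s x + v)) has_derivative (\<lambda>h. D (c *s x + v) (c *s h))) (at x)" .
  qed (simp add: * mult_ac)
qed

lemma Hol_linear: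
  fixes f :: "complex ^ 'n \<Rightarrow> complex"
  assumes "\<And>x y. f (x + y) = f x + f y" and f: "\<And>c x. f (c *s x) = c * f x"
  shows "f \<in> Hol"
proof -
  have "linear f" by (intro linearI) (simp_all add: assms scaleR_eq_smult scaleR_conv_of_real[where 'a=complex])
  then have "bounded_linear f" using linear_conv_bounded_linear by blast
  then show ?thesis unfolding Hol_def using f
    by (auto intro!: exI[of _ f] bounded_linear_imp_has_derivative)
qed

text \<open>A quadratic Taylor remainder spares differentiation under the integral sign by dominated convergence:
  for exponential integrals both the derivative and the remainder are explicit.\<close>

lemma Hol_I_quadratic_remainder:
  fixes f :: "complex ^ 'n \<Rightarrow> complex"
  assumes add: "\<And>x v w. D x (v + w) = D x v + D x w" and smult: "\<And>x c v. D x (c *s v) = c * D x v"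
    and rem: "\<And>x. \<exists>K. \<forall>v. norm v \<le> 1 \<longrightarrow> norm (f (x + v) - f x - D x v) \<le> K * (norm v)\<^sup>2"
  shows "f \<in> Hol"
  unfolding Hol_def
proof (clarify, intro exI conjI)
  fix x
  have "linear (D x)" by (intro linearI) (simp_all add: add smult scaleR_eq_smult scaleR_conv_of_real[where 'a=complex])
  then have bl: "bounded_linear (D x)" using linear_conv_bounded_linear by blast
  obtain K where K: "\<And>v. norm v \<le> 1 \<Longrightarrow> norm (f (x + v) - f x - D x v) \<le> K * (norm v)\<^sup>2"
    using rem by blast
  have "((\<lambda>v. norm (f (x + v) - f x - D x v) / norm v) \<longlongrightarrow> 0) (at 0)"
  proof (rule Lim_null_comparison)
    show "((\<lambda>v. K * norm v) \<longlongrightarrow> 0) (at (0 :: complex ^ 'n))"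
      by (auto intro!: tendsto_eq_intros)
    have "\<forall>\<^sub>F v in at (0 :: complex ^ 'n). norm v < 1"
      by (rule order_tendstoD(2)[of _ 0]) (auto intro!: tendsto_eq_intros)
    then show "\<forall>\<^sub>F v in at 0. norm (norm (f (x + v) - f x - D x v) / norm v) \<le> K * norm v"
    proof eventually_elim
      case (elim v)
      then show ?case using K[of v] by (cases "v = 0") (auto simp: field_simps power2_eq_square)
    qed
  qed
  then show "(f has_derivative D x) (at x)"
    using bl by (simp add: has_derivative_at)
qed (auto simp: smult)

text \<open>Cauchy's formula on the unit circle for the entire function \<open>\<zeta> \<mapsto> u(\<zeta> z)\<close> of one variable.\<close>

lemma circle_mean_value:
  fixes u :: "complex ^ 'n \<Rightarrow> complex"
  assumes u: "u \<in> Hol"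
  shows "(\<integral>t. indicator {0..1} t *\<^sub>R u (cis (2 * pi * t) *s z) \<partial>lborel) = u 0"
proof -
  define f where "f = (\<lambda>\<zeta>. u (\<zeta> *s z))"
  obtain D where D: "\<And>x. (u has_derivative D x) (at x)" "\<And>x c v. D x (c *s v) = c * D x v"
    using Hol_derivative[OF u] by metis
  have "(f has_field_derivative D (\<zeta> *s z) z) (at \<zeta>)" for \<zeta>
  proof -
    have "linear (\<lambda>\<zeta>::complex. \<zeta> *s z)"
      by (intro linearI) (simp_all add: vec_eq_iff algebra_simps scaleR_conv_of_real[where 'a=complex])
    then have "((\<lambda>\<zeta>. \<zeta> *s z) has_derivative (\<lambda>h. h *s z)) (at \<zeta>)"
      using linear_conv_bounded_linear bounded_linear_imp_has_derivative by blast
    from has_derivative_compose[OF this D(1)] show ?thesis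
      unfolding has_field_derivative_def f_def by (simp add: D mult.commute[of _ "D (\<zeta> *s z) z"] cong: if_cong)
  qed
  then have hol: "f holomorphic_on S" for S
    by (auto simp: holomorphic_on_def field_differentiable_def intro: has_field_derivative_at_within)
  have cont: "continuous_on S f" for S
    using hol by (rule holomorphic_on_imp_continuous_on)
  have "((\<lambda>w. f w / (w - 0)) has_contour_integral (2 * of_real pi * \<i> * f 0)) (circlepath 0 1)"
    by (rule Cauchy_integral_circlepath) (auto intro: hol cont)
  then have "((\<lambda>t. f (circlepath 0 1 t) / circlepath 0 1 t *
      (2 * of_real pi * \<i> * exp (2 * of_real pi * \<i> * of_real t))) has_integral (2 * of_real pi * \<i> * f 0)) {0..1}"
    unfolding has_contour_integral_def
    by (rule has_integral_eq[rotated]) (simp add: vector_derivative_circlepath01)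
  then have "((\<lambda>t. (2 * of_real pi * \<i>) * f (cis (2 * pi * t))) has_integral (2 * of_real pi * \<i> * f 0)) {0..1}"
    by (rule has_integral_eq[rotated]) (simp add: circlepath cis_conv_exp mult_ac)
  then have I: "((\<lambda>t. f (cis (2 * pi * t))) has_integral f 0) {0..1}"
  proof -
    have cancel: "(g has_integral y) S" if "((\<lambda>t. c * g t) has_integral c * y) S" "c \<noteq> 0"
      for c y :: complex and g :: "real \<Rightarrow> complex" and S
      using has_integral_mult_right[OF that(1), of "inverse c"] that(2)
      by (simp add: mult.assoc[symmetric])
    assume "((\<lambda>t. (2 * of_real pi * \<i>) * f (cis (2 * pi * t))) has_integral (2 * of_real pi * \<i> * f 0)) {0..1}"
    from cancel[OF this] show ?thesis by simp
  qed
  have "set_integrable lborel {0..1} (\<lambda>t. f (cis (2 * pi * t)))"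
    by (intro borel_integrable_atLeastAtMost' continuous_on_compose2[OF cont[of UNIV]] continuous_intros) auto
  then have "(\<integral>t. indicator {0..1} t *\<^sub>R f (cis (2 * pi * t)) \<partial>lborel) = integral {0..1} (\<lambda>t. f (cis (2 * pi * t)))"
    using set_borel_integral_eq_integral(2) by (auto simp: set_lebesgue_integral_def)
  also have "\<dots> = f 0" using I by (rule integral_unique)
  finally show ?thesis by (simp add: f_def)
qed

section \<open>Positive Hermitian forms\<close>

locale positive_hermitian_form =
  fixes H :: "complex ^ 'n \<Rightarrow> complex ^ 'n \<Rightarrow> complex"
  assumes add_left: "H (x + y) z = H x z + H y z"
    and smult_left: "H (c *s x) z = c * H x z"
    and hermitian: "H y x = cnj (H x y)"
    and pos: "x \<noteq> 0 \<Longrightarrow> Re (H x x) > 0"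
begin

lemma add_right: "H x (y + z) = H x y + H x z"
  using add_left[of y z x] by (metis hermitian complex_cnj_add)

lemma smult_right: "H x (c *s y) = cnj c * H x y"
  using smult_left[of c y x] by (metis hermitian complex_cnj_mult)

lemma minus_left: "H (- x) y = - H x y" and minus_right: "H x (- y) = - H x y"
  using smult_left[of "-1" x y] smult_right[of x "-1" y] by simp_all

lemma diff_left: "H (x - y) z = H x z - H y z" and diff_right: "H x (y - z) = H x y - H x z"
  using add_left[of x "-y" z] add_right[of x y "-z"] by (simp_all add: minus_left minus_right)

lemma zero_left [simp]: "H 0 y = 0" and zero_right [simp]: "H x 0 = 0"
  using diff_left[of 0 0 y] diff_right[of x 0 0] by simp_all

lemma scaleR_left: "H (r *\<^sub>R x) y = of_real r * H x y"
  and scaleR_right: "H x (r *\<^sub>R y) = of_real r * H x y"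
  by (simp_all add: scaleR_eq_smult smult_left smult_right)

lemmas expand = add_left add_right diff_left diff_right minus_left minus_right scaleR_left scaleR_right

lemma Im_diag [simp]: "Im (H x x) = 0"
  using hermitian[of x x] by (simp add: complex_eq_iff)

lemma diag_real: "H x x = of_real (Re (H x x))"
  by (simp add: complex_eq_iff)

lemma bilinear_form: "bilinear H"
  unfolding bilinear_def by (auto intro!: linearI simp: expand scaleR_conv_of_real[where 'a=complex])

lemma norm_bound_ex: "\<exists>K>0. \<forall>x y. norm (H x y) \<le> K * norm x * norm y"
  using bilinear_bounded_pos[OF bilinear_form] by blast

lemma continuous_on_form [continuous_intros]:
  assumes "continuous_on S f" "continuous_on S g"
  shows "continuous_on S (\<lambda>x. H (f x) (g x))"
proof -
  interpret bounded_bilinear H using bilinear_form bilinear_conv_bounded_bilinear by blast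
  show ?thesis using assms by (rule continuous_on)
qed

lemma measurable_form [measurable (raw)]:
  assumes [measurable]: "f \<in> borel_measurable M" "g \<in> borel_measurable M"
  shows "(\<lambda>x. H (f x) (g x)) \<in> borel_measurable M"
proof -
  have "continuous_on UNIV (\<lambda>p. H (fst p) (snd p))" by (intro continuous_intros)
  then have [measurable]: "(\<lambda>p. H (fst p) (snd p)) \<in> borel_measurable borel"
    by (rule borel_measurable_continuous_onI)
  have "(\<lambda>x. (f x, g x)) \<in> borel_measurable M" by measurable
  from measurable_compose[OF this \<open>(\<lambda>p. H (fst p) (snd p)) \<in> borel_measurable borel\<close>]
  show ?thesis by simp
qed

lemma coercive_ex: "\<exists>d>0. \<forall>x. d * (norm x)\<^sup>2 \<le> Re (H x x)"
proof -
  have "\<exists>x\<in>sphere 0 1. \<forall>y\<in>sphere 0 1. Re (H x x) \<le> Re (H y y)"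
  proof (rule continuous_attains_inf)
    obtain b :: "complex ^ 'n" where "b \<in> Basis" using nonempty_Basis by blast
    then show "sphere (0 :: complex ^ 'n) 1 \<noteq> {}" by (auto intro!: exI[of _ b])
  qed (auto intro!: continuous_intros)
  then obtain x where x: "norm x = 1" "\<And>y. norm y = 1 \<Longrightarrow> Re (H x x) \<le> Re (H y y)" by auto
  have "Re (H x x) > 0" using x(1) by (intro pos) auto
  moreover have "Re (H x x) * (norm y)\<^sup>2 \<le> Re (H y y)" for y
  proof (cases "y = 0")
    case False
    then have "Re (H x x) \<le> Re (H ((1 / norm y) *\<^sub>R y) ((1 / norm y) *\<^sub>R y))"
      by (intro x) simp
    also have "\<dots> = Re (H y y) / (norm y)\<^sup>2"
      by (simp add: scaleR_left scaleR_right power2_eq_square Re_divide_of_real flip: of_real_mult)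
    finally show ?thesis using False by (simp add: field_simps)
  qed simp
  ultimately show ?thesis by blast
qed

text \<open>Fixed constants for the two-sided comparison of \<open>H\<close> with the Euclidean norm.\<close>

definition form_bound where
  "form_bound = (SOME k. k > 0 \<and> (\<forall>x y. norm (H x y) \<le> k * norm x * norm y))"

definition coercivity where
  "coercivity = (SOME c. c > 0 \<and> (\<forall>x. c * (norm x)\<^sup>2 \<le> Re (H x x)))"

lemma form_bound: "form_bound > 0" "norm (H x y) \<le> form_bound * norm x * norm y"
  using someI_ex[OF norm_bound_ex, folded form_bound_def] by auto

lemma coercivity: "coercivity > 0" "coercivity * (norm x)\<^sup>2 \<le> Re (H x x)"
  using someI_ex[OF coercive_ex, folded coercivity_def] by auto

lemma Hol_form [intro]: "(\<lambda>x. H x y) \<in> Hol"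
  by (rule Hol_linear) (simp_all add: expand smult_left)

lemma integrable_exp_diag: "c > 0 \<Longrightarrow> integrable lborel (\<lambda>x. exp (- c * Re (H x x)))"
  using coercivity(1) by (intro Bochner_Integration.integrable_bound[OF integrable_gaussian[of "c * coercivity"]])
     (auto simp: coercivity(2))

lemma exp_diag_le_decay: "\<exists>C\<ge>0. \<forall>x. exp (- Re (H x x)) \<le> C * decay x"
proof -
  obtain C where "C \<ge> 0" "\<And>x::complex ^ 'n. norm x ^ 0 * exp (- coercivity * (norm x)\<^sup>2) \<le> C * decay x"
    using gaussian_le_decay[OF coercivity(1)] by blast
  then show ?thesis
    using coercivity(2) by (intro exI[of _ C]) (auto, meson exp_le_cancel_iff neg_le_iff_le order_trans)
qed

definition gauss_mass :: real where
  "gauss_mass = (\<integral>z. exp (- 2 * Re (H z z)) \<partial>lborel)"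

lemma gauss_mass_pos: "gauss_mass > 0"
proof -
  have int: "integrable lborel (\<lambda>z. exp (- 2 * Re (H z z)))"
    by (rule integrable_exp_diag) simp
  have "gauss_mass \<noteq> 0"
  proof
    assume "gauss_mass = 0"
    then have "AE x in (lborel :: (complex ^ 'n) measure). False"
      unfolding gauss_mass_def by (subst (asm) integral_nonneg_eq_0_iff_AE[OF int]) auto
    then show False by (simp add: AE_iff_measurable[of UNIV])
  qed
  moreover have "gauss_mass \<ge> 0" unfolding gauss_mass_def by simp
  ultimately show ?thesis by simp
qed

text \<open>The operator whose kernel, after conjugation by the weight \<open>e\<^bsup>H(x,x)\<^esup>\<close>, is \<open>\<kappa>\<close>. Estimates on the
  weighted space thus become estimates on \<open>\<kappa>\<close> in plain \<open>L\<^sup>2\<close>.\<close>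

definition weighted_op ::
  "(complex ^ 'n \<Rightarrow> complex ^ 'n \<Rightarrow> complex) \<Rightarrow> (complex ^ 'n \<Rightarrow> complex) \<Rightarrow> complex ^ 'n \<Rightarrow> complex" where
  "weighted_op \<kappa> u x = exp (H x x) * (\<integral>z. \<kappa> x z * (exp (- H z z) * u z) \<partial>lborel)"

definition weighted_L2 :: "(complex ^ 'n \<Rightarrow> complex) set" where
  "weighted_L2 = {u \<in> borel_measurable borel. integrable lborel (\<lambda>x. (norm (u x))\<^sup>2 * exp (- 2 * Re (H x x)))}"

definition sq_norm :: "(complex ^ 'n \<Rightarrow> complex) \<Rightarrow> real" where
  "sq_norm u = (\<integral>x. (norm (u x))\<^sup>2 * exp (- 2 * Re (H x x)) \<partial>lborel)"

lemma norm_weighted_sq: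
  "(norm (exp (- H z z) * w))\<^sup>2 = (norm w)\<^sup>2 * exp (- 2 * Re (H z z))"
  by (simp add: norm_mult power_mult_distrib norm_exp_eq_Re flip: exp_double)

lemma
  assumes \<kappa>: "case_prod \<kappa> \<in> borel_measurable (borel \<Otimes>\<^sub>M borel)"
    and bound: "\<And>x z. norm (\<kappa> x z) \<le> C * decay (x - z)"
    and u: "u \<in> weighted_L2"
  shows integrable_weighted_op: "integrable lborel (\<lambda>z. \<kappa> x z * (exp (- H z z) * u z))"
    and weighted_op_L2: "weighted_op \<kappa> u \<in> weighted_L2"
    and weighted_op_bound:
      "sq_norm (weighted_op \<kappa> u) \<le> (C * integral\<^sup>L lborel (decay :: complex ^ 'n \<Rightarrow> real))\<^sup>2 * sq_norm u"
proof -
  let ?f = "\<lambda>z. exp (- H z z) * u z"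
  have u' [measurable]: "u \<in> borel_measurable borel" using u by (simp add: weighted_L2_def)
  have f [measurable]: "?f \<in> borel_measurable borel" by measurable
  have f2: "integrable lborel (\<lambda>x. (norm (?f x))\<^sup>2)"
    using u by (simp add: norm_weighted_sq weighted_L2_def)
  note S = schur_test[OF \<kappa> bound f f2]
  show "integrable lborel (\<lambda>z. \<kappa> x z * ?f z)" by (rule S(1))
  let ?g = "\<lambda>x. \<integral>z. \<kappa> x z * ?f z \<partial>lborel"
  have [measurable]: "?g \<in> borel_measurable borel" by (rule S(2))
  have g: "(norm (weighted_op \<kappa> u x))\<^sup>2 * exp (- 2 * Re (H x x)) = (norm (?g x))\<^sup>2" for x
  proof -
    have "(exp r * m)\<^sup>2 * exp (- 2 * r) = m\<^sup>2" for r m :: real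
      by (simp add: power_mult_distrib exp_minus field_simps flip: exp_double)
    then show ?thesis by (simp add: weighted_op_def norm_mult norm_exp_eq_Re)
  qed
  show "weighted_op \<kappa> u \<in> weighted_L2"
    unfolding weighted_L2_def
  proof (intro CollectI conjI)
    show "weighted_op \<kappa> u \<in> borel_measurable borel"
      unfolding weighted_op_def[abs_def] by measurable
    show "integrable lborel (\<lambda>x. (norm (weighted_op \<kappa> u x))\<^sup>2 * exp (- 2 * Re (H x x)))"
      unfolding g by (rule S(3))
  qed
  show "sq_norm (weighted_op \<kappa> u) \<le> (C * integral\<^sup>L lborel (decay :: complex ^ 'n \<Rightarrow> real))\<^sup>2 * sq_norm u"
    using S(4) unfolding sq_norm_def g norm_weighted_sq .
qed

lemma weighted_op_linear:
  assumes "case_prod \<kappa> \<in> borel_measurable (borel \<Otimes>\<^sub>M borel)" "\<And>x z. norm (\<kappa> x z) \<le> C * decay (x - z)"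
    and "u \<in> weighted_L2" "v \<in> weighted_L2"
  shows "weighted_op \<kappa> (\<lambda>x. u x + v x) = (\<lambda>x. weighted_op \<kappa> u x + weighted_op \<kappa> v x)"
    and "weighted_op \<kappa> (\<lambda>x. c * u x) = (\<lambda>x. c * weighted_op \<kappa> u x)"
proof -
  note i = integrable_weighted_op[OF assms(1,2)]
  show "weighted_op \<kappa> (\<lambda>x. u x + v x) = (\<lambda>x. weighted_op \<kappa> u x + weighted_op \<kappa> v x)"
    using i[OF assms(3)] i[OF assms(4)] unfolding weighted_op_def by (simp add: distrib_left)
  show "weighted_op \<kappa> (\<lambda>x. c * u x) = (\<lambda>x. c * weighted_op \<kappa> u x)"
    unfolding weighted_op_def by (simp add: mult.left_commute[of _ c])
qed

end

section \<open>The Bergman projection\<close>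

lemma exp_remainder_2:
  fixes z :: complex
  shows "norm (exp z - 1 - z) \<le> (norm z)\<^sup>2 * exp (norm z)"
proof -
  have "norm (exp z - 1 - z) \<le> exp \<bar>Re z\<bar> * (norm z)\<^sup>2"
    using Taylor_exp[of z 1] by (simp add: power2_eq_square mult_ac diff_diff_eq)
  also have "\<dots> \<le> exp (norm z) * (norm z)\<^sup>2"
    by (intro mult_right_mono) (auto simp: abs_Re_le_cmod)
  finally show ?thesis by (simp add: mult.commute)
qed

context positive_hermitian_form
begin

text \<open>The reproducing kernel \<open>e\<^bsup>2H(x,z)\<^esup>\<close> of the weighted space of entire functions in conjugated form.
  Its modulus is \<open>e\<^bsup>-H(x-z,x-z)\<^esup>\<close> up to the normalization.\<close>

definition bergman_kernel :: "complex ^ 'n \<Rightarrow> complex ^ 'n \<Rightarrow> complex" where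
  "bergman_kernel x z = exp (2 * H x z - H x x - H z z) / gauss_mass"

abbreviation bergman where "bergman \<equiv> weighted_op bergman_kernel"

lemma measurable_bergman_kernel: "case_prod bergman_kernel \<in> borel_measurable (borel \<Otimes>\<^sub>M borel)"
  unfolding bergman_kernel_def[abs_def] by measurable

lemma Re_swap: "Re (H y x) = Re (H x y)" and Im_swap: "Im (H y x) = - Im (H x y)"
  by (subst hermitian, simp)+

lemma bergman_kernel_bound_ex: "\<exists>C. \<forall>x z. norm (bergman_kernel x z) \<le> C * decay (x - z)"
proof -
  obtain C where C: "C \<ge> 0" "\<And>x. exp (- Re (H x x)) \<le> C * decay x"
    using exp_diag_le_decay by blast
  have "norm (bergman_kernel x z) \<le> (C / gauss_mass) * decay (x - z)" for x z
  proof -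
    have "norm (bergman_kernel x z) = exp (- Re (H (x - z) (x - z))) / gauss_mass"
      using gauss_mass_pos by (simp add: bergman_kernel_def norm_divide norm_exp_eq_Re expand Re_swap[of x z])
    also have "\<dots> \<le> (C * decay (x - z)) / gauss_mass"
      using C gauss_mass_pos by (intro divide_right_mono) auto
    finally show ?thesis by simp
  qed
  then show ?thesis by blast
qed

lemma bergman_eq:
  "bergman u x = (\<integral>z. exp (2 * H x z) * (exp (- 2 * H z z) * u z) \<partial>lborel) / gauss_mass"
proof -
  have "exp (H x x) * (bergman_kernel x z * (exp (- H z z) * u z))
      = exp (2 * H x z) * (exp (- 2 * H z z) * u z) / gauss_mass" for z
  proof -
    have "exp (H x x) * exp (2 * H x z - H x x - H z z) * exp (- H z z) = exp (2 * H x z) * exp (- 2 * H z z)"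
      by (simp flip: exp_add)
    then show ?thesis by (simp add: bergman_kernel_def mult.assoc[symmetric])
  qed
  then have "(\<integral>z. exp (H x x) * (bergman_kernel x z * (exp (- H z z) * u z)) \<partial>lborel)
     = (\<integral>z. exp (2 * H x z) * (exp (- 2 * H z z) * u z) / gauss_mass \<partial>lborel)"
    by simp
  then show ?thesis unfolding weighted_op_def by simp
qed

text \<open>With \<open>\<zeta> = 2 H(v,z)\<close>, the increment of \<open>e\<^bsup>2H(x,z)\<^esup>\<close> from \<open>x\<close> to \<open>x + v\<close> is \<open>e\<^bsup>2H(x,z)\<^esup> (e\<^sup>\<zeta> - 1)\<close>, whose distance
  from its linear part is at most \<open>|\<zeta>|\<^sup>2 e\<^bsup>|\<zeta>|\<^esup>\<close> times the exponential. The factor \<open>|z|\<^sup>2\<close> coming from \<open>|\<zeta>|\<^sup>2\<close> is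
  absorbed into \<open>e\<^bsup>2|z|\<^esup>\<close>.\<close>

lemma Hol_exponential_integral:
  assumes [measurable]: "g \<in> borel_measurable borel"
    and int: "\<And>A. integrable lborel (\<lambda>z. exp (A * norm z) * norm (g z))"
  shows "(\<lambda>x. \<integral>z. exp (2 * H x z) * g z \<partial>lborel) \<in> Hol"
proof -
  let ?D = "\<lambda>x v. \<integral>z. 2 * H v z * (exp (2 * H x z) * g z) \<partial>lborel"
  have e: "norm (exp (2 * H x z)) \<le> exp (2 * form_bound * norm x * norm z)" for x z
    using order_trans[OF complex_Re_le_cmod form_bound(2)[of x z]] by (simp add: norm_exp_eq_Re mult_ac)
  have n: "norm z \<le> exp (norm z)" for z :: "complex ^ 'n"
    using exp_ge_add_one_self[of "norm z"] by linarith
  have i0: "integrable lborel (\<lambda>z. exp (2 * H x z) * g z)" for x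
  proof (rule Bochner_Integration.integrable_bound[OF int[of "2 * form_bound * norm x"]])
    have "norm (exp (2 * H x z) * g z) \<le> exp (2 * form_bound * norm x * norm z) * norm (g z)" for z
      unfolding norm_mult by (rule mult_right_mono[OF e norm_ge_zero])
    then show "AE z in lborel. norm (exp (2 * H x z) * g z) \<le> norm (exp (2 * form_bound * norm x * norm z) * norm (g z))"
      by simp
  qed measurable
  have i1: "integrable lborel (\<lambda>z. 2 * H v z * (exp (2 * H x z) * g z))" for x v
  proof (rule Bochner_Integration.integrable_bound)
    show "integrable lborel (\<lambda>z. 2 * form_bound * norm v * (exp ((1 + 2 * form_bound * norm x) * norm z) * norm (g z)))"
      using int by simp
    show "AE z in lborel. norm (2 * H v z * (exp (2 * H x z) * g z))
        \<le> norm (2 * form_bound * norm v * (exp ((1 + 2 * form_bound * norm x) * norm z) * norm (g z)))"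
    proof (rule AE_I2)
      fix z
      have "norm (2 * H v z) \<le> 2 * (form_bound * norm v * exp (norm z))"
        using order_trans[OF form_bound(2)[of v z] mult_left_mono[OF n[of z], of "form_bound * norm v"]] form_bound(1)
        by (simp add: norm_mult)
      then have "norm (2 * H v z) * (norm (exp (2 * H x z)) * norm (g z))
         \<le> 2 * (form_bound * norm v * exp (norm z)) * (exp (2 * form_bound * norm x * norm z) * norm (g z))"
        using form_bound(1) by (intro mult_mono e) auto
      also have "\<dots> = 2 * form_bound * norm v * (exp ((1 + 2 * form_bound * norm x) * norm z) * norm (g z))"
      proof -
        have "exp ((1 + 2 * form_bound * norm x) * norm z) = exp (norm z) * exp (2 * form_bound * norm x * norm z)"
          by (simp add: distrib_right exp_add)
        then show ?thesis by (simp only: mult_ac)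
      qed
      finally show "norm (2 * H v z * (exp (2 * H x z) * g z))
        \<le> norm (2 * form_bound * norm v * (exp ((1 + 2 * form_bound * norm x) * norm z) * norm (g z)))"
        using form_bound(1) by (simp add: norm_mult)
    qed
  qed measurable
  show ?thesis
  proof (rule Hol_I_quadratic_remainder[of ?D])
    show "?D x (v + w) = ?D x v + ?D x w" for x v w
      using i1 by (simp add: expand distrib_left distrib_right flip: Bochner_Integration.integral_add)
    show "?D x (c *s v) = c * ?D x v" for x c v
      by (simp add: smult_left mult.assoc mult.left_commute[of _ c])
    fix x :: "complex ^ 'n"
    let ?A = "2 + 2 * form_bound + 2 * form_bound * norm x"
    let ?M = "\<integral>z. exp (?A * norm z) * norm (g z) \<partial>lborel"
    show "\<exists>B. \<forall>v. norm v \<le> 1 \<longrightarrow>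
        norm ((\<integral>z. exp (2 * H (x + v) z) * g z \<partial>lborel) - (\<integral>z. exp (2 * H x z) * g z \<partial>lborel) - ?D x v)
          \<le> B * (norm v)\<^sup>2"
    proof (intro exI allI impI)
      fix v :: "complex ^ 'n" assume v: "norm v \<le> 1"
      let ?r = "\<lambda>z. exp (2 * H (x + v) z) * g z - exp (2 * H x z) * g z - 2 * H v z * (exp (2 * H x z) * g z)"
      have "norm (?r z) \<le> 4 * form_bound\<^sup>2 * (norm v)\<^sup>2 * (exp (?A * norm z) * norm (g z))" for z
      proof -
        let ?\<zeta> = "2 * H v z"
        have \<zeta>: "norm ?\<zeta> \<le> 2 * (form_bound * norm v * norm z)" using form_bound(2)[of v z] by (simp add: norm_mult)
        have z: "form_bound * norm v * norm z \<le> form_bound * norm z"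
          using v form_bound(1) by (intro mult_right_mono) (auto simp: mult_left_le)
        have "norm (exp ?\<zeta> - 1 - ?\<zeta>) \<le> (norm ?\<zeta>)\<^sup>2 * exp (norm ?\<zeta>)" by (rule exp_remainder_2)
        also have "\<dots> \<le> (2 * (form_bound * norm v * norm z))\<^sup>2 * exp (2 * form_bound * norm z)"
          using \<zeta> z by (intro mult_mono power_mono) auto
        also have "\<dots> \<le> (4 * form_bound\<^sup>2 * (norm v)\<^sup>2 * exp (2 * norm z)) * exp (2 * form_bound * norm z)"
        proof (intro mult_right_mono)
          have "(norm z)\<^sup>2 \<le> (exp (norm z))\<^sup>2" by (intro power_mono n) auto
          then have "(norm z)\<^sup>2 \<le> exp (2 * norm z)" by (simp flip: exp_double)
          then have "4 * form_bound\<^sup>2 * (norm v)\<^sup>2 * (norm z)\<^sup>2 \<le> 4 * form_bound\<^sup>2 * (norm v)\<^sup>2 * exp (2 * norm z)"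
            by (intro mult_left_mono) auto
          then show "(2 * (form_bound * norm v * norm z))\<^sup>2 \<le> 4 * form_bound\<^sup>2 * (norm v)\<^sup>2 * exp (2 * norm z)"
            by (simp add: power_mult_distrib mult_ac)
        qed auto
        finally have 1: "norm (exp ?\<zeta> - 1 - ?\<zeta>) \<le> 4 * form_bound\<^sup>2 * (norm v)\<^sup>2 * (exp (2 * norm z) * exp (2 * form_bound * norm z))"
          by (simp add: mult_ac)
        have "?r z = (exp ?\<zeta> - 1 - ?\<zeta>) * (exp (2 * H x z) * g z)"
          by (simp add: expand distrib_left exp_add left_diff_distrib)
        then have "norm (?r z) = norm (exp ?\<zeta> - 1 - ?\<zeta>) * (norm (exp (2 * H x z)) * norm (g z))"
          by (simp add: norm_mult)
        also have "\<dots> \<le> (4 * form_bound\<^sup>2 * (norm v)\<^sup>2 * (exp (2 * norm z) * exp (2 * form_bound * norm z)))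
            * (exp (2 * form_bound * norm x * norm z) * norm (g z))"
          by (intro mult_mono 1 e) auto
        also have "\<dots> = 4 * form_bound\<^sup>2 * (norm v)\<^sup>2 * (exp (?A * norm z) * norm (g z))"
          by (simp add: ring_distribs exp_add mult_ac)
        finally show ?thesis .
      qed
      moreover have ir: "integrable lborel ?r" using i0 i1 by simp
      ultimately have "norm (\<integral>z. ?r z \<partial>lborel) \<le> (\<integral>z. 4 * form_bound\<^sup>2 * (norm v)\<^sup>2 * (exp (?A * norm z) * norm (g z)) \<partial>lborel)"
        using int[of ?A] by (intro order_trans[OF integral_norm_bound integral_mono]) auto
      also have "\<dots> = (4 * form_bound\<^sup>2 * ?M) * (norm v)\<^sup>2" by simp
      finally show "norm ((\<integral>z. exp (2 * H (x + v) z) * g z \<partial>lborel) - (\<integral>z. exp (2 * H x z) * g z \<partial>lborel) - ?D x v)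
          \<le> (4 * form_bound\<^sup>2 * ?M) * (norm v)\<^sup>2"
        using i0 i1 by simp
    qed
  qed
qed

text \<open>A square integrable function against a Gaussian has all exponential moments, by
  \<open>p q \<le> p\<^sup>2 + q\<^sup>2\<close> with \<open>p\<close> carrying the exponential and the Gaussian.\<close>

lemma Hol_bergman:
  assumes u: "u \<in> weighted_L2"
  shows "bergman u \<in> Hol"
proof -
  let ?g = "\<lambda>z. exp (- 2 * H z z) * u z"
  have u' [measurable]: "u \<in> borel_measurable borel"
    and u2: "integrable lborel (\<lambda>x. (norm (u x))\<^sup>2 * exp (- 2 * Re (H x x)))"
    using u by (simp_all add: weighted_L2_def)
  have "integrable lborel (\<lambda>z. exp (A * norm z) * norm (?g z))" for A
  proof (rule Bochner_Integration.integrable_bound)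
    show "integrable lborel (\<lambda>z. exp (A\<^sup>2 / coercivity) * exp (- coercivity * (norm z)\<^sup>2) + (norm (u z))\<^sup>2 * exp (- 2 * Re (H z z)))"
      using u2 integrable_gaussian[OF coercivity(1)] by auto
    show "AE z in lborel. norm (exp (A * norm z) * norm (?g z))
      \<le> norm (exp (A\<^sup>2 / coercivity) * exp (- coercivity * (norm z)\<^sup>2) + (norm (u z))\<^sup>2 * exp (- 2 * Re (H z z)))"
    proof (rule AE_I2)
      fix z
      let ?p = "exp (A * norm z - Re (H z z))" and ?q = "norm (u z) * exp (- Re (H z z))"
      have "exp (A * norm z) * norm (?g z) = ?p * ?q"
        by (simp add: norm_mult norm_exp_eq_Re mult_ac flip: exp_add)
      also have "\<dots> \<le> ?p\<^sup>2 + ?q\<^sup>2"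
      proof -
        have "x * y \<le> x\<^sup>2 + y\<^sup>2" if "x \<ge> 0" "y \<ge> 0" for x y :: real
        proof -
          have "0 \<le> x * y" using that by simp
          then show ?thesis using sum_squares_bound[of x y] by linarith
        qed
        then show ?thesis by simp
      qed
      also have "?p\<^sup>2 \<le> exp (A\<^sup>2 / coercivity) * exp (- coercivity * (norm z)\<^sup>2)"
      proof -
        \<comment> \<open>completing the square absorbs the linear exponent into half of the Gaussian\<close>
        have "0 \<le> (coercivity * norm z - A)\<^sup>2 / coercivity" using coercivity(1) by simp
        also have "\<dots> = coercivity * (norm z)\<^sup>2 - 2 * A * norm z + A\<^sup>2 / coercivity"
          using coercivity(1) by (simp add: field_simps power2_eq_square)
        finally have "2 * (A * norm z - Re (H z z)) \<le> A\<^sup>2 / coercivity + - coercivity * (norm z)\<^sup>2"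
          using coercivity(2)[of z] by simp
        then show ?thesis by (simp flip: exp_add exp_double)
      qed
      also have "?q\<^sup>2 = (norm (u z))\<^sup>2 * exp (- 2 * Re (H z z))"
        by (simp add: power_mult_distrib flip: exp_double)
      finally show "norm (exp (A * norm z) * norm (?g z))
        \<le> norm (exp (A\<^sup>2 / coercivity) * exp (- coercivity * (norm z)\<^sup>2) + (norm (u z))\<^sup>2 * exp (- 2 * Re (H z z)))"
        by simp
    qed
  qed measurable
  from Hol_mult[OF Hol_exponential_integral[OF _ this] Hol_const[of "1 / gauss_mass"]]
  show ?thesis by (simp add: bergman_eq[abs_def])
qed

text \<open>The rotations \<open>z \<mapsto> e\<^bsup>\<i>t\<^esup> z\<close> preserve both Lebesgue measure and \<open>H(z,z)\<close>, so \<open>u\<close> may be replaced by its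
  average over the circle through \<open>z\<close>, which is \<open>u(0)\<close>.\<close>

lemma gaussian_mean_value:
  fixes u :: "complex ^ 'n \<Rightarrow> complex"
  assumes u: "u \<in> Hol" and bound: "\<And>z. norm (u z) \<le> C * exp (Re (H z z))"
  shows "(\<integral>z. exp (- 2 * H z z) * u z \<partial>lborel) = gauss_mass * u 0"
proof -
  have [measurable]: "u \<in> borel_measurable borel" by (rule Hol_measurable[OF u])
  let ?f = "\<lambda>z. exp (- 2 * H z z) * u z"
  let ?F = "\<lambda>(t::real) z. indicator {0..1} t *\<^sub>R (exp (- 2 * H z z) * u (cis (2 * pi * t) *s z))"
  have rot: "H (cis r *s z) (cis r *s z) = H z z" for r z
    by (simp add: smult_left smult_right mult.assoc[symmetric] complex_norm_square[symmetric] flip: mult.commute[of "cis r" "cnj (cis r)"])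
  have [measurable]: "(\<lambda>p. cis (2 * pi * fst p) *s (snd p :: complex ^ 'n)) \<in> borel_measurable borel"
  proof (rule borel_measurable_continuous_onI)
    show "continuous_on UNIV (\<lambda>p. cis (2 * pi * fst p) *s (snd p :: complex ^ 'n))"
      unfolding vector_scalar_mult_def by (intro continuous_intros continuous_on_vec_lambda)
  qed
  have "(\<lambda>p. u (cis (2 * pi * fst p) *s snd p)) \<in> borel_measurable (borel :: (real \<times> (complex ^ 'n)) measure)"
    by measurable
  then have [measurable]: "(\<lambda>(t, z). u (cis (2 * pi * t) *s z)) \<in> borel_measurable (lborel \<Otimes>\<^sub>M lborel)"
    by (simp add: case_prod_beta borel_prod[symmetric] cong: measurable_cong_sets)
  have bF: "norm (?F t z) \<le> indicator {0..1} t * (C * exp (- Re (H z z)))" for t z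
  proof -
    have "norm (exp (- 2 * H z z) * u (cis (2 * pi * t) *s z)) \<le> exp (- 2 * Re (H z z)) * (C * exp (Re (H z z)))"
      using bound[of "cis (2 * pi * t) *s z"] by (simp add: norm_mult norm_exp_eq_Re rot)
    also have "\<dots> = C * exp (- Re (H z z))" by (simp add: mult_ac flip: exp_add)
    finally show ?thesis by (auto simp: indicator_def)
  qed
  have int: "integrable (lborel \<Otimes>\<^sub>M lborel) (case_prod ?F)"
  proof (rule Bochner_Integration.integrable_bound)
    show "integrable (lborel \<Otimes>\<^sub>M lborel) (\<lambda>(t, z). indicator {0..1::real} t * (C * exp (- Re (H z z))))"
      using integrable_exp_diag[of 1]
      by (intro integrable_pair_mult) auto
    show "case_prod ?F \<in> borel_measurable (lborel \<Otimes>\<^sub>M lborel)" by measurable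
    show "AE p in lborel \<Otimes>\<^sub>M lborel. norm (case_prod ?F p) \<le> norm (case p of (t, z) \<Rightarrow> indicator {0..1::real} t * (C * exp (- Re (H z z))))"
      unfolding case_prod_beta real_norm_def by (intro AE_I2 order_trans[OF bF abs_ge_self])
  qed
  have "(\<integral>z. (\<integral>t. ?F t z \<partial>lborel) \<partial>lborel) = (\<integral>t. (\<integral>z. ?F t z \<partial>lborel) \<partial>lborel)"
    by (rule lborel_pair.Fubini_integral[OF int])
  also have "\<dots> = (\<integral>t. indicator {0..1::real} t *\<^sub>R (\<integral>z. ?f z \<partial>lborel) \<partial>lborel)"
  proof (intro Bochner_Integration.integral_cong refl)
    fix t :: real
    have "(\<integral>z. ?f (cis (2 * pi * t) *s z) \<partial>lborel) = (\<integral>z. ?f z \<partial>lborel)"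
      by (rule integral_lborel_isometry) (auto simp: linear_smult norm_smult)
    then show "(\<integral>z. ?F t z \<partial>lborel) = indicator {0..1} t *\<^sub>R (\<integral>z. ?f z \<partial>lborel)"
      by (simp add: rot)
  qed
  also have "\<dots> = (\<integral>z. ?f z \<partial>lborel)" by simp
  finally have "(\<integral>z. ?f z \<partial>lborel) = (\<integral>z. (\<integral>t. ?F t z \<partial>lborel) \<partial>lborel)" by simp
  also have "\<dots> = (\<integral>z. exp (- 2 * H z z) * u 0 \<partial>lborel)"
  proof (intro Bochner_Integration.integral_cong refl)
    fix z
    have "(\<integral>t. ?F t z \<partial>lborel) = (\<integral>t. exp (- 2 * H z z) * (indicator {0..1} t *\<^sub>R u (cis (2 * pi * t) *s z)) \<partial>lborel)"
      by simp
    also have "\<dots> = exp (- 2 * H z z) * (\<integral>t. indicator {0..1} t *\<^sub>R u (cis (2 * pi * t) *s z) \<partial>lborel)"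
      by (rule integral_mult_right_zero)
    finally show "(\<integral>t. ?F t z \<partial>lborel) = exp (- 2 * H z z) * u 0"
      by (simp add: circle_mean_value[OF u])
  qed
  also have "\<dots> = (\<integral>z. complex_of_real (exp (- 2 * Re (H z z))) * u 0 \<partial>lborel)"
    by (subst diag_real) (simp add: exp_of_real[symmetric])
  also have "\<dots> = gauss_mass * u 0"
    by (simp add: gauss_mass_def integral_complex_of_real)
  finally show ?thesis .
qed

text \<open>The case of a general point follows from the mean value at the origin for
  \<open>z \<mapsto> e\<^bsup>-2H(z,x)\<^esup> u(x + z)\<close>. The exponential factor compensates the translation of the weight: it keeps the
  growth below \<open>e\<^bsup>H(z,z)\<^esup>\<close> and stays holomorphic in \<open>z\<close>.\<close>

lemma bergman_reproduces:
  fixes u :: "complex ^ 'n \<Rightarrow> complex"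
  assumes u: "u \<in> Hol" and bound: "\<And>z. norm (u z) \<le> C * exp (Re (H z z))"
  shows "bergman u x = u x"
proof -
  let ?v = "\<lambda>z. exp (- 2 * H z x) * u (1 *s z + x)"
  have "(\<lambda>z. exp (- 2 * H z x)) \<in> Hol"
    by (intro Hol_exp Hol_mult Hol_const Hol_form)
  then have v: "?v \<in> Hol" by (intro Hol_mult Hol_affine u)
  have "norm (?v z) \<le> (C * exp (Re (H x x))) * exp (Re (H z z))" for z
  proof -
    have "norm (?v z) \<le> exp (- 2 * Re (H z x)) * (C * exp (Re (H (z + x) (z + x))))"
      using bound[of "z + x"] by (simp add: norm_mult norm_exp_eq_Re)
    also have "\<dots> = C * exp (- 2 * Re (H z x) + Re (H (z + x) (z + x)))"
      by (simp only: exp_add mult_ac)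
    also have "- 2 * Re (H z x) + Re (H (z + x) (z + x)) = Re (H x x) + Re (H z z)"
      by (simp add: expand Re_swap[of x z])
    finally show ?thesis by (simp add: exp_add mult_ac)
  qed
  from gaussian_mean_value[OF v this]
  have "(\<integral>z. exp (- 2 * H z z) * ?v z \<partial>lborel) = gauss_mass * u x" by simp
  moreover have "(\<integral>z. exp (2 * H x z) * (exp (- 2 * H z z) * u z) \<partial>lborel) = (\<integral>z. exp (- 2 * H z z) * ?v z \<partial>lborel)"
  proof (subst integral_lborel_translate[of _ x], intro Bochner_Integration.integral_cong refl)
    fix z
    have "2 * H x (x + z) + - 2 * H (x + z) (x + z) = - 2 * H z z + - 2 * H z x"
      by (simp add: expand)
    then have "exp (2 * H x (x + z)) * exp (- 2 * H (x + z) (x + z)) = exp (- 2 * H z z) * exp (- 2 * H z x)"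
      by (simp only: flip: exp_add)
    then show "exp (2 * H x (x + z)) * (exp (- 2 * H (x + z) (x + z)) * u (x + z)) = exp (- 2 * H z z) * ?v z"
      by (simp only: mult.assoc[symmetric] vector_smult_lid add.commute[of z x])
  qed
  ultimately show ?thesis using gauss_mass_pos by (simp add: bergman_eq)
qed

end

section \<open>Weyl quantization with a Hermitian weight\<close>

context positive_hermitian_form
begin

text \<open>Derivatives of a Gaussian are polynomials times it. Allowing the powers of \<open>Re H(t,e)\<close> from the start
  makes the induction on the number of derivatives close up.\<close>

lemma gaussian_line_derivs:
  fixes I :: "'i set"
  shows "bounded_line_derivs e decay I N
     (\<lambda>i t. complex_of_real (Re (H t e) ^ k * exp (- Re (H t t))))"
proof (induction N arbitrary: k)
  case 0
  obtain C where C: "C \<ge> 0" "\<And>x::complex ^ 'n. norm x ^ k * exp (- coercivity * (norm x)\<^sup>2) \<le> C * decay x"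
    using gaussian_le_decay[OF coercivity(1)] by blast
  have "norm (complex_of_real (Re (H t e) ^ k * exp (- Re (H t t)))) \<le> ((form_bound * norm e) ^ k * C) * decay t" for t
  proof -
    have "norm (complex_of_real (Re (H t e) ^ k * exp (- Re (H t t)))) = \<bar>Re (H t e)\<bar> ^ k * exp (- Re (H t t))"
      by (simp add: norm_mult norm_power)
    also have "\<dots> \<le> (form_bound * norm t * norm e) ^ k * exp (- coercivity * (norm t)\<^sup>2)"
      using coercivity(2)[of t] form_bound(1) by (intro mult_mono power_mono order_trans[OF abs_Re_le_cmod form_bound(2)]) auto
    also have "\<dots> = (form_bound * norm e) ^ k * (norm t ^ k * exp (- coercivity * (norm t)\<^sup>2))"
      by (simp add: power_mult_distrib)
    also have "\<dots> \<le> (form_bound * norm e) ^ k * (C * decay t)"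
      using form_bound(1) by (intro mult_left_mono C) auto
    finally show ?thesis by (simp add: mult.assoc)
  qed
  then show ?case by (auto intro!: continuous_intros)
next
  case (Suc N)
  let ?G = "\<lambda>k t. complex_of_real (Re (H t e) ^ k * exp (- Re (H t t)))"
  \<comment> \<open>for \<open>k = 0\<close> the truncated exponent \<open>k - 1\<close> is harmless, since its coefficient vanishes\<close>
  let ?D = "\<lambda>(i::'i) t. of_nat k * of_real (Re (H e e)) * ?G (k - 1) t + (-2) * ?G (Suc k) t"
  show ?case
  proof (rule bounded_line_derivs_SucI)
    show "bounded_line_derivs e decay I 0 (\<lambda>i t. ?G k t)" by (rule bounded_line_derivs_0[OF Suc])
    show "bounded_line_derivs e decay I N ?D"
      by (rule bounded_line_derivs_add[OF bounded_line_derivs_cmult[OF Suc] bounded_line_derivs_cmult[OF Suc]])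
    fix i t
    let ?a = "Re (H t e)" and ?c = "Re (H e e)" and ?h = "Re (H t t)"
    have "((\<lambda>r. (?a + r * ?c) ^ k * exp (- (?h + 2 * r * ?a + r\<^sup>2 * ?c))) has_real_derivative
        real k * ?c * (?a ^ (k - 1) * exp (- ?h)) + (-2) * (?a ^ Suc k * exp (- ?h))) (at 0)"
      by (auto intro!: derivative_eq_intros simp: algebra_simps)
    then have "((\<lambda>r. complex_of_real ((?a + r * ?c) ^ k * exp (- (?h + 2 * r * ?a + r\<^sup>2 * ?c)))) has_vector_derivative
        of_real (real k * ?c * (?a ^ (k - 1) * exp (- ?h)) + (-2) * (?a ^ Suc k * exp (- ?h)))) (at 0)"
      by (intro has_vector_derivative_of_real) (simp add: has_real_derivative_iff_has_vector_derivative)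
    moreover have "Re (H (t + r *\<^sub>R e) e) = ?a + r * ?c"
      "Re (H (t + r *\<^sub>R e) (t + r *\<^sub>R e)) = ?h + 2 * r * ?a + r\<^sup>2 * ?c" for r
      by (simp_all add: expand Re_swap[of e t] power2_eq_square algebra_simps)
    ultimately show "((\<lambda>r. ?G k (t + r *\<^sub>R e)) has_vector_derivative ?D i t) (at 0)"
      by simp
  qed
qed

text \<open>The quantization of the model case \<open>\<Phi> = H\<close>, \<open>h = 1\<close>, without the constant in front: there
  \<open>\<i> (x - y) \<cdot> \<theta> = 2 H(x - y, (x + y)/2)\<close>.\<close>

definition weyl :: "(complex ^ 'n \<Rightarrow> complex) \<Rightarrow> (complex ^ 'n \<Rightarrow> complex) \<Rightarrow> complex ^ 'n \<Rightarrow> complex" where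
  "weyl b u x = (\<integral>y. exp (H (x - y) (x + y)) * b ((1/2) *\<^sub>R (x + y)) * u y \<partial>lborel)"

text \<open>The conjugated kernel of the composition of \<open>weyl b\<close> with the Bergman projection, after the
  intermediate point has been written as \<open>z + t\<close>. This centring is what makes the real part of the
  exponent the pure Gaussian \<open>- H(t,t)\<close> and leaves only a frequency linear in \<open>x - z\<close>.\<close>

definition weyl_kernel :: "(complex ^ 'n \<Rightarrow> complex) \<Rightarrow> complex ^ 'n \<Rightarrow> complex ^ 'n \<Rightarrow> complex" where
  "weyl_kernel b x z = cis (2 * Im (H x z)) / gauss_mass *
     (\<integral>t. cis (2 * Im (H (x - z) t)) *
          (complex_of_real (exp (- Re (H t t))) * b ((1/2) *\<^sub>R (x + z) + (1/2) *\<^sub>R t)) \<partial>lborel)"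

lemma measurable_weyl_kernel:
  assumes [measurable]: "b \<in> borel_measurable borel"
  shows "case_prod (weyl_kernel b) \<in> borel_measurable (borel \<Otimes>\<^sub>M borel)"
  unfolding weyl_kernel_def[abs_def] cis_conv_exp by measurable

text \<open>The frequency \<open>t \<mapsto> 2 Im H(x,t)\<close> takes the value \<open>2 H(x,x)\<close> at \<open>t = -\<i> x\<close>, so it cannot be small on all basis
  vectors.\<close>

lemma dual_direction:
  fixes x :: "complex ^ 'n"
  shows "\<exists>e\<in>Basis. 2 * coercivity * norm x \<le> real (DIM(complex ^ 'n)) * \<bar>2 * Im (H x e)\<bar>"
proof (rule ccontr)
  let ?l = "\<lambda>t. 2 * Im (H x t)"
  assume "\<not> ?thesis"
  then have less: "real (DIM(complex ^ 'n)) * \<bar>?l e\<bar> < 2 * coercivity * norm x" if "e \<in> Basis" for e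
    using that by (simp add: not_le)
  obtain e0 :: "complex ^ 'n" where e0: "e0 \<in> Basis" using nonempty_Basis by blast
  have x: "x \<noteq> 0" using less[OF e0] by auto
  let ?v = "(- \<i>) *s x"
  have l: "linear ?l" by (intro linearI) (simp_all add: expand algebra_simps)
  have "2 * coercivity * (norm x)\<^sup>2 \<le> 2 * Re (H x x)" using coercivity(2)[of x] by simp
  also have "\<dots> = ?l ?v" by (subst smult_right) simp
  also have "\<dots> = (\<Sum>e\<in>Basis. (?v \<bullet> e) * ?l e)"
    by (subst (1) euclidean_representation[of ?v, symmetric])
       (simp only: linear_sum[OF l] linear_scale[OF l] real_scaleR_def)
  also have "\<dots> \<le> (\<Sum>e\<in>(Basis :: (complex ^ 'n) set). norm x * \<bar>?l e\<bar>)"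
  proof (rule sum_mono)
    fix e :: "complex ^ 'n" assume e: "e \<in> Basis"
    have "\<bar>?v \<bullet> e\<bar> \<le> norm x" using Basis_le_norm[OF e, of ?v] by (simp only: norm_smult) simp
    then have "\<bar>?v \<bullet> e\<bar> * \<bar>?l e\<bar> \<le> norm x * \<bar>?l e\<bar>" by (intro mult_right_mono) auto
    then show "(?v \<bullet> e) * ?l e \<le> norm x * \<bar>?l e\<bar>"
      by (rule order_trans[OF abs_ge_self, OF ord_eq_le_trans[OF abs_mult]])
  qed
  also have "\<dots> < (\<Sum>e\<in>(Basis :: (complex ^ 'n) set). norm x * (2 * coercivity * norm x / DIM(complex ^ 'n)))"
    using less x e0 by (intro sum_strict_mono mult_strict_left_mono) (auto simp: field_simps)
  also have "\<dots> = 2 * coercivity * (norm x)\<^sup>2"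
    by (simp add: power2_eq_square)
  finally show False by simp
qed

text \<open>By \<open>dual_direction\<close> some basis vector sees a frequency of size at least a multiple of \<open>|x - z|\<close>. Integrating by
  parts \<open>2 D\<close> times in that direction, with \<open>D\<close> the real dimension, gains \<open>|x - z|\<^bsup>-2D\<^esup>\<close>, the rate of \<open>decay\<close>;
  the estimate without integration by parts covers small \<open>|x - z|\<close>.\<close>

lemma weyl_kernel_bound:
  fixes b :: "complex ^ 'n \<Rightarrow> complex"
  assumes b: "smooth b" and bound: "\<And>vs. vs \<in> lists Basis \<Longrightarrow> \<exists>C. \<forall>x. norm (iter_deriv vs b x) \<le> C"
  shows "\<exists>C. \<forall>s\<in>{0<..1}. \<forall>x z. norm (weyl_kernel (\<lambda>m. b (s *\<^sub>R m)) x z) \<le> C * decay (x - z)"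
proof -
  let ?D = "DIM(complex ^ 'n)"
  let ?I = "{0<..1::real} \<times> (UNIV :: (complex ^ 'n) set)"
  let ?f = "\<lambda>(s, c) t. complex_of_real (exp (- Re (H t t))) * b (s *\<^sub>R (c + (1/2) *\<^sub>R t))"
  have dec: "bounded_line_derivs e decay ?I N ?f" if "e \<in> Basis" for e N
    using bounded_line_derivs_mult[OF gaussian_line_derivs[of e ?I N 0] smooth_line_derivs[OF b bound that, of N]]
    by (simp add: case_prod_beta')
  have F: "\<exists>C. \<forall>i\<in>?I. \<forall>l. linear l \<longrightarrow> \<bar>l e\<bar> ^ N * norm (\<integral>t. cis (l t) * ?f i t \<partial>lborel) \<le> C"
    if "e \<in> Basis" for e N
    by (rule fourier_integral_decay[OF dec[OF that] integrable_decay])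
  have "\<exists>C. \<forall>e\<in>Basis. \<forall>i\<in>?I. \<forall>l. linear l \<longrightarrow> \<bar>l e\<bar> ^ N * norm (\<integral>t. cis (l t) * ?f i t \<partial>lborel) \<le> C" for N
  proof -
    have "\<forall>e\<in>Basis. \<exists>C. \<forall>i\<in>?I. \<forall>l. linear l \<longrightarrow>
        \<bar>l e\<bar> ^ N * norm (\<integral>t. cis (l t) * ?f i t \<partial>lborel) \<le> C"
      by (intro ballI F)
    from bchoice[OF this] obtain C where C: "\<forall>e\<in>Basis. \<forall>i\<in>?I. \<forall>l. linear l \<longrightarrow>
        \<bar>l e\<bar> ^ N * norm (\<integral>t. cis (l t) * ?f i t \<partial>lborel) \<le> C e"
      by (rule exE)
    have "C e \<le> (\<Sum>e\<in>Basis. \<bar>C e\<bar>)" if "e \<in> Basis" for e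
      using member_le_sum[OF that, of "\<lambda>e. \<bar>C e\<bar>"] by simp
    with C have "\<forall>e\<in>Basis. \<forall>i\<in>?I. \<forall>l. linear l \<longrightarrow>
        \<bar>l e\<bar> ^ N * norm (\<integral>t. cis (l t) * ?f i t \<partial>lborel) \<le> (\<Sum>e\<in>Basis. \<bar>C e\<bar>)"
      by (blast intro: order_trans)
    then show ?thesis by (rule exI)
  qed
  then have "\<forall>N. \<exists>C. \<forall>e\<in>Basis. \<forall>i\<in>?I. \<forall>l. linear l \<longrightarrow>
      \<bar>l e\<bar> ^ N * norm (\<integral>t. cis (l t) * ?f i t \<partial>lborel) \<le> C" by (rule allI)
  from choice[OF this] obtain C where "\<forall>N. \<forall>e\<in>Basis. \<forall>i\<in>?I. \<forall>l. linear l \<longrightarrow>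
      \<bar>l e\<bar> ^ N * norm (\<integral>t. cis (l t) * ?f i t \<partial>lborel) \<le> C N" by (rule exE)
  then have C: "\<bar>l e\<bar> ^ N * norm (\<integral>t. cis (l t) * ?f i t \<partial>lborel) \<le> C N"
    if "e \<in> Basis" "i \<in> ?I" "linear l" for N e i l
    using that by blast
  define M where "M = 2 ^ ?D * (C 0 + (real ?D / (2 * coercivity)) ^ (2 * ?D) * C (2 * ?D)) / gauss_mass"
  have "norm (weyl_kernel (\<lambda>m. b (s *\<^sub>R m)) x z) \<le> M * decay (x - z)" if s: "s \<in> {0<..1}" for s x z
  proof -
    define r where "r = norm (x - z)"
    let ?l = "\<lambda>t. 2 * Im (H (x - z) t)"
    let ?J = "norm (\<integral>t. cis (?l t) * ?f (s, (1/2) *\<^sub>R (x + z)) t \<partial>lborel)"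
    have l: "linear ?l" by (intro linearI) (simp_all add: expand algebra_simps)
    have i: "(s, (1/2) *\<^sub>R (x + z)) \<in> ?I" using s by simp
    obtain e where e: "e \<in> Basis" "2 * coercivity * r \<le> real ?D * \<bar>?l e\<bar>"
      using dual_direction[of "x - z"] unfolding r_def by blast
    have "r \<le> real ?D / (2 * coercivity) * \<bar>?l e\<bar>" using e coercivity(1) by (simp add: field_simps)
    then have "r ^ (2 * ?D) \<le> (real ?D / (2 * coercivity) * \<bar>?l e\<bar>) ^ (2 * ?D)"
      by (intro power_mono) (auto simp: r_def)
    then have "r ^ (2 * ?D) * ?J \<le> (real ?D / (2 * coercivity) * \<bar>?l e\<bar>) ^ (2 * ?D) * ?J"
      by (rule mult_right_mono) simp
    also have "\<dots> = (real ?D / (2 * coercivity)) ^ (2 * ?D) * (\<bar>?l e\<bar> ^ (2 * ?D) * ?J)"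
      by (simp only: power_mult_distrib mult.assoc)
    also have "\<dots> \<le> (real ?D / (2 * coercivity)) ^ (2 * ?D) * C (2 * ?D)"
      using coercivity(1) by (intro mult_left_mono C[OF e(1) i l]) auto
    finally have 1: "(1 + r ^ (2 * ?D)) * ?J \<le> C 0 + (real ?D / (2 * coercivity)) ^ (2 * ?D) * C (2 * ?D)"
      using C[OF e(1) i l, of 0] by (simp add: distrib_right)
    have r: "(1 + r\<^sup>2) ^ ?D \<le> 2 ^ ?D * (1 + r ^ (2 * ?D))"
    proof -
      have "(1 + r\<^sup>2) ^ ?D \<le> (2 * max 1 (r\<^sup>2)) ^ ?D" by (intro power_mono) auto
      also have "\<dots> \<le> 2 ^ ?D * (1 + r ^ (2 * ?D))"
        by (auto simp: power_mult_distrib max_def r_def simp flip: power_mult)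
      finally show ?thesis .
    qed
    have "?J = decay (x - z) * ((1 + r\<^sup>2) ^ ?D * ?J)"
    proof -
      have "1 + r\<^sup>2 > 0" by (intro add_pos_nonneg) auto
      then show ?thesis unfolding decay_def r_def[symmetric] by simp
    qed
    also have "\<dots> \<le> decay (x - z) * (2 ^ ?D * ((1 + r ^ (2 * ?D)) * ?J))"
      unfolding mult.assoc[symmetric, of "2 ^ ?D"] by (intro mult_left_mono mult_right_mono r) auto
    also have "\<dots> \<le> decay (x - z) * (2 ^ ?D * (C 0 + (real ?D / (2 * coercivity)) ^ (2 * ?D) * C (2 * ?D)))"
      by (intro mult_left_mono 1) auto
    finally have J: "?J \<le> (M * gauss_mass) * decay (x - z)"
      using gauss_mass_pos by (simp add: M_def mult.commute)
    have "norm (weyl_kernel (\<lambda>m. b (s *\<^sub>R m)) x z) = ?J / gauss_mass"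
      using gauss_mass_pos by (simp add: weyl_kernel_def norm_mult norm_divide)
    also have "\<dots> \<le> M * decay (x - z)"
      using J gauss_mass_pos by (simp add: divide_le_eq mult_ac)
    finally show ?thesis .
  qed
  then show ?thesis by blast
qed

lemma rapid_bound:
  fixes u :: "complex ^ 'n \<Rightarrow> complex"
  assumes "\<And>y. norm (u y) \<le> A * (decay y * exp (Re (H y y)))"
  shows "A \<ge> 0" "norm (u y) \<le> A * exp (Re (H y y))" "exp (- Re (H y y)) * norm (u y) \<le> A * decay y"
proof -
  show A: "A \<ge> 0"
    using order_trans[OF norm_ge_zero assms[of 0]] decay_pos[of "0 :: complex ^ 'n"] by (simp add: zero_le_mult_iff)
  show "norm (u y) \<le> A * exp (Re (H y y))"
    by (rule order_trans[OF assms]) (use A decay_le_1 in \<open>auto intro!: mult_left_mono simp: mult_left_le_one_le\<close>)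
  have "exp (- Re (H y y)) * norm (u y) \<le> exp (- Re (H y y)) * (A * (decay y * exp (Re (H y y))))"
    by (intro mult_left_mono assms) auto
  then show "exp (- Re (H y y)) * norm (u y) \<le> A * decay y" by (simp add: exp_minus field_simps)
qed

text \<open>Insert \<open>u = \<Pi> u\<close> and exchange the integrals. The double integral converges absolutely because \<open>u\<close>
  decays: the intermediate point is tied to \<open>z\<close> by the Gaussian, and \<open>z\<close> is controlled by \<open>u\<close> alone.\<close>

lemma weyl_eq_weighted_op:
  fixes u :: "complex ^ 'n \<Rightarrow> complex"
  assumes b [measurable]: "b \<in> borel_measurable borel" and B: "\<And>x. norm (b x) \<le> B"
    and u: "u \<in> Hol" and bound: "\<And>y. norm (u y) \<le> A * (decay y * exp (Re (H y y)))"
  shows "weyl b u x = weighted_op (weyl_kernel b) u x"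
proof -
  have [measurable]: "u \<in> borel_measurable borel" by (rule Hol_measurable[OF u])
  note A = rapid_bound[OF bound]
  have B0: "B \<ge> 0" using order_trans[OF norm_ge_zero B] .
  obtain E where E: "E \<ge> 0" "\<And>x. exp (- Re (H x x)) \<le> E * decay x" using exp_diag_le_decay by blast
  let ?F = "\<lambda>z y. exp (H (x - y) (x + y)) * b ((1/2) *\<^sub>R (x + y)) * (exp (2 * H y z) * (exp (- 2 * H z z) * u z) / gauss_mass)"
  have F: "norm (?F z y) \<le> (exp (Re (H x x)) * B * A * E / gauss_mass) * (decay z * decay (y - z))" for z y
  proof -
    have "norm (?F z y) = (norm (b ((1/2) *\<^sub>R (x + y))) / gauss_mass) *
        (exp (Re (H (x - y) (x + y)) + 2 * Re (H y z) - 2 * Re (H z z)) * norm (u z))"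
      using gauss_mass_pos by (simp add: norm_mult norm_divide norm_exp_eq_Re exp_add exp_diff exp_minus field_simps)
    also have "Re (H (x - y) (x + y)) + 2 * Re (H y z) - 2 * Re (H z z)
        = Re (H x x) + (- Re (H (y - z) (y - z)) + - Re (H z z))"
      by (simp add: expand Re_swap[of x y] Re_swap[of y z])
    also have "norm (b ((1/2) *\<^sub>R (x + y))) / gauss_mass *
        (exp (Re (H x x) + (- Re (H (y - z) (y - z)) + - Re (H z z))) * norm (u z))
      = norm (b ((1/2) *\<^sub>R (x + y))) / gauss_mass * (exp (Re (H x x)) * (exp (- Re (H (y - z) (y - z))) *
          (exp (- Re (H z z)) * norm (u z))))"
      by (simp only: exp_add mult.assoc)
    also have "\<dots> \<le> B / gauss_mass * (exp (Re (H x x)) * ((E * decay (y - z)) * (A * decay z)))"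
      using gauss_mass_pos B0 E(1) A(1)
      by (intro mult_mono divide_right_mono B A(3) E(2) mult_nonneg_nonneg divide_nonneg_nonneg) auto
    finally show ?thesis by (simp add: mult_ac)
  qed
  have int: "integrable (lborel \<Otimes>\<^sub>M lborel) (case_prod ?F)"
  proof (rule Bochner_Integration.integrable_bound)
    show "integrable (lborel \<Otimes>\<^sub>M lborel) (\<lambda>p. (exp (Re (H x x)) * B * A * E / gauss_mass) *
        (case p of (z, y) \<Rightarrow> decay z * decay (y - z :: complex ^ 'n)))"
      by (intro integrable_mult_right integrable_pair_mult_diff integrable_decay)
    show "case_prod ?F \<in> borel_measurable (lborel \<Otimes>\<^sub>M lborel)" by measurable
    show "AE p in lborel \<Otimes>\<^sub>M lborel. norm (case_prod ?F p) \<le> norm ((exp (Re (H x x)) * B * A * E / gauss_mass) *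
        (case p of (z, y) \<Rightarrow> decay z * decay (y - z :: complex ^ 'n)))"
      unfolding case_prod_beta real_norm_def by (intro AE_I2 order_trans[OF F abs_ge_self])
  qed
  have "weyl b u x = (\<integral>y. (\<integral>z. ?F z y \<partial>lborel) \<partial>lborel)"
    unfolding weyl_def
  proof (intro Bochner_Integration.integral_cong refl)
    fix y
    have "(\<integral>z. ?F z y \<partial>lborel) = exp (H (x - y) (x + y)) * b ((1/2) *\<^sub>R (x + y)) * bergman u y"
      by (simp add: bergman_eq)
    then show "exp (H (x - y) (x + y)) * b ((1/2) *\<^sub>R (x + y)) * u y = (\<integral>z. ?F z y \<partial>lborel)"
      using bergman_reproduces[OF u A(2)] by simp
  qed
  also have "\<dots> = (\<integral>z. (\<integral>y. ?F z y \<partial>lborel) \<partial>lborel)"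
    by (rule lborel_pair.Fubini_integral[OF int])
  also have "\<dots> = (\<integral>z. exp (H x x) * (weyl_kernel b x z * (exp (- H z z) * u z)) \<partial>lborel)"
  proof (intro Bochner_Integration.integral_cong refl)
    fix z
    have e: "exp (H (x - (z + t)) (x + (z + t))) * (exp (2 * H (z + t) z) * exp (- 2 * H z z))
       = exp (H x x) * (cis (2 * Im (H x z)) * (exp (- H z z) * (cis (2 * Im (H (x - z) t)) * complex_of_real (exp (- Re (H t t))))))" for t
    proof -
      have "H (x - (z + t)) (x + (z + t)) + (2 * H (z + t) z + - 2 * H z z)
          = H x x + (\<i> * of_real (2 * Im (H x z)) + (- H z z + (\<i> * of_real (2 * Im (H (x - z) t)) + - H t t)))"
        by (simp add: expand complex_eq_iff Re_swap[of x z] Re_swap[of x t] Re_swap[of z t]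
              Im_swap[of x z] Im_swap[of x t] Im_swap[of z t])
      moreover have "complex_of_real (exp (- Re (H t t))) = exp (- H t t)"
        by (subst (2) diag_real) (simp flip: exp_of_real)
      ultimately show ?thesis by (simp only: cis_conv_exp mult_exp_exp)
    qed
    have "(\<integral>y. ?F z y \<partial>lborel) = (\<integral>t. ?F z (z + t) \<partial>lborel)"
      by (rule integral_lborel_translate)
    also have "\<dots> = (\<integral>t. (exp (H x x) * (cis (2 * Im (H x z)) / gauss_mass) * (exp (- H z z) * u z)) * (cis (2 * Im (H (x - z) t)) *
          (complex_of_real (exp (- Re (H t t))) * b ((1/2) *\<^sub>R (x + z) + (1/2) *\<^sub>R t))) \<partial>lborel)"
    proof (intro Bochner_Integration.integral_cong refl)
      fix t
      let ?b = "b ((1/2) *\<^sub>R (x + z) + (1/2) *\<^sub>R t)"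
      have "?F z (z + t) = (exp (H (x - (z + t)) (x + (z + t))) * (exp (2 * H (z + t) z) * exp (- 2 * H z z))) * (?b * u z / gauss_mass)"
        by (simp add: scaleR_add_right add.assoc)
      also note e
      finally show "?F z (z + t) = (exp (H x x) * (cis (2 * Im (H x z)) / gauss_mass) * (exp (- H z z) * u z)) * (cis (2 * Im (H (x - z) t)) *
          (complex_of_real (exp (- Re (H t t))) * ?b))"
        by simp
    qed
    also have "\<dots> = exp (H x x) * (weyl_kernel b x z * (exp (- H z z) * u z))"
      by (subst integral_mult_right_zero) (simp add: weyl_kernel_def)
    finally show "(\<integral>y. ?F z y \<partial>lborel) = exp (H x x) * (weyl_kernel b x z * (exp (- H z z) * u z))" .
  qed
  also have "\<dots> = weighted_op (weyl_kernel b) u x"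
    unfolding weighted_op_def by (rule integral_mult_right_zero)
  finally show ?thesis .
qed

text \<open>The substitution \<open>y = p - z\<close> exhibits \<open>weyl b u\<close> as an integral over \<open>p\<close> of the functions \<open>R p\<close>, the
  reflections of \<open>u\<close> in the points \<open>p/2\<close> weighted by the symbol. Each of them is entire and of growth \<open>e\<^bsup>H(z,z)\<^esup>\<close>,
  hence reproduced by the projection, and Fubini carries this over to the integral.\<close>

lemma bergman_weyl:
  fixes u :: "complex ^ 'n \<Rightarrow> complex"
  assumes b [measurable]: "b \<in> borel_measurable borel" and B: "\<And>x. norm (b x) \<le> B"
    and u: "u \<in> Hol" and bound: "\<And>y. norm (u y) \<le> A * (decay y * exp (Re (H y y)))"
  shows "bergman (weyl b u) x = weyl b u x"
proof -
  have [measurable]: "u \<in> borel_measurable borel" by (rule Hol_measurable[OF u])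
  note A = rapid_bound[OF bound]
  have B0: "B \<ge> 0" using order_trans[OF norm_ge_zero B] .
  obtain E where E: "E \<ge> 0" "\<And>x. exp (- Re (H x x)) \<le> E * decay x" using exp_diag_le_decay by blast
  define R where "R p z = exp (H (2 *\<^sub>R z - p) p) * b ((1/2) *\<^sub>R p) * u (p - z)" for p z
  have R_bound: "norm (R p z) \<le> (B * A) * (decay (p - z) * exp (Re (H z z)))" for p z
  proof -
    have "norm (R p z) \<le> exp (Re (H (2 *\<^sub>R z - p) p)) * B * (A * (decay (p - z) * exp (Re (H (p - z) (p - z)))))"
      unfolding R_def norm_mult norm_exp_eq_Re
      using B0 by (intro mult_mono B bound) auto
    also have "\<dots> = (B * A) * (decay (p - z) * exp (Re (H (2 *\<^sub>R z - p) p) + Re (H (p - z) (p - z))))"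
      by (simp only: exp_add mult_ac)
    also have "Re (H (2 *\<^sub>R z - p) p) + Re (H (p - z) (p - z)) = Re (H z z)"
      by (simp add: expand Re_swap[of p z])
    finally show ?thesis .
  qed
  have R_Hol: "R p \<in> Hol" for p
  proof -
    have "(\<lambda>z. exp (2 * H z p + - H p p) * b ((1/2) *\<^sub>R p) * u ((-1) *s z + p)) \<in> Hol"
      by (intro Hol_mult Hol_exp Hol_add Hol_const Hol_form Hol_affine u)
    moreover have "(-1) *s z + p = p - z" for z :: "complex ^ 'n" by (simp add: vec_eq_iff)
    ultimately show ?thesis unfolding R_def[abs_def] by (simp add: expand)
  qed
  have R_rep: "bergman (R p) x = R p x" for p
  proof (rule bergman_reproduces[OF R_Hol])
    show "norm (R p z) \<le> (B * A) * exp (Re (H z z))" for z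
      by (rule order_trans[OF R_bound]) (use A B0 decay_le_1[of "p - z"] in
          \<open>auto intro!: mult_left_mono simp: mult_left_le_one_le\<close>)
  qed
  have weyl_R: "weyl b u z = (\<integral>p. R p z \<partial>lborel)" for z
  proof -
    have "weyl b u z = (\<integral>p. exp (H (z - (- z + p)) (z + (- z + p))) * b ((1/2) *\<^sub>R (z + (- z + p))) * u (- z + p) \<partial>lborel)"
      unfolding weyl_def by (rule integral_lborel_translate)
    moreover have "z - (- z + p) = 2 *\<^sub>R z - p" for p by (simp add: scaleR_2)
    ultimately show ?thesis by (simp add: R_def)
  qed
  let ?F = "\<lambda>p z. exp (2 * H x z) * (exp (- 2 * H z z) * R p z)"
  have F: "norm (?F p z) \<le> (exp (Re (H x x)) * B * A * E) * (decay (z - x) * decay (p - z))" for p z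
  proof -
    have "norm (?F p z) \<le> exp (2 * Re (H x z)) * (exp (- 2 * Re (H z z)) * ((B * A) * (decay (p - z) * exp (Re (H z z)))))"
      unfolding norm_mult norm_exp_eq_Re using R_bound[of p z] by simp
    also have "\<dots> = (B * A) * (decay (p - z) * exp (2 * Re (H x z) + (- 2 * Re (H z z) + Re (H z z))))"
      by (simp only: exp_add mult_ac)
    also have "2 * Re (H x z) + (- 2 * Re (H z z) + Re (H z z)) = Re (H x x) + - Re (H (z - x) (z - x))"
      by (simp add: expand Re_swap[of x z])
    also have "(B * A) * (decay (p - z) * exp (Re (H x x) + - Re (H (z - x) (z - x))))
        = (B * A) * (decay (p - z) * (exp (Re (H x x)) * exp (- Re (H (z - x) (z - x)))))"
      by (simp only: exp_add)
    also have "\<dots> \<le> (B * A) * (decay (p - z) * (exp (Re (H x x)) * (E * decay (z - x))))"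
      using B0 A(1) by (intro mult_left_mono E(2)) auto
    finally show ?thesis by (simp only: mult_ac)
  qed
  have int: "integrable (lborel \<Otimes>\<^sub>M lborel) (\<lambda>(z, p). ?F p z)"
  proof (rule Bochner_Integration.integrable_bound)
    show "integrable (lborel \<Otimes>\<^sub>M lborel) (\<lambda>p. (exp (Re (H x x)) * B * A * E) *
        (case p of (z, p) \<Rightarrow> decay (z - x) * decay (p - z :: complex ^ 'n)))"
      by (intro integrable_mult_right integrable_pair_mult_diff integrable_decay integrable_decay_diff)
    show "(\<lambda>(z, p). ?F p z) \<in> borel_measurable (lborel \<Otimes>\<^sub>M lborel)" unfolding R_def by measurable
    show "AE p in lborel \<Otimes>\<^sub>M lborel. norm (case p of (z, p) \<Rightarrow> ?F p z) \<le> norm ((exp (Re (H x x)) * B * A * E) *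
        (case p of (z, p) \<Rightarrow> decay (z - x) * decay (p - z :: complex ^ 'n)))"
      unfolding case_prod_beta real_norm_def by (intro AE_I2 order_trans[OF F abs_ge_self])
  qed
  have "gauss_mass * bergman (weyl b u) x = (\<integral>z. (\<integral>p. ?F p z \<partial>lborel) \<partial>lborel)"
    using gauss_mass_pos by (simp add: bergman_eq weyl_R)
  also have "\<dots> = (\<integral>p. (\<integral>z. ?F p z \<partial>lborel) \<partial>lborel)"
    by (rule lborel_pair.Fubini_integral[OF int, symmetric])
  also have "\<dots> = (\<integral>p. gauss_mass * R p x \<partial>lborel)"
  proof (intro Bochner_Integration.integral_cong refl)
    fix p
    show "(\<integral>z. ?F p z \<partial>lborel) = gauss_mass * R p x"
      using R_rep[of p] gauss_mass_pos by (simp add: bergman_eq field_simps)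
  qed
  also have "\<dots> = gauss_mass * weyl b u x" by (simp add: weyl_R)
  finally show ?thesis using gauss_mass_pos by simp
qed

text \<open>The operator is the composition of the projection with the operator of kernel \<open>weyl_kernel\<close>. The
  projection is there to make the values entire for every square integrable argument, where the
  integral defining \<open>weyl\<close> need not converge.\<close>

theorem bounded_weyl_extension:
  fixes b :: "complex ^ 'n \<Rightarrow> complex"
  assumes b: "smooth b" and bound: "\<And>vs. vs \<in> lists Basis \<Longrightarrow> \<exists>C. \<forall>x. norm (iter_deriv vs b x) \<le> C"
  shows "\<exists>T C. C \<ge> 0 \<and> (\<forall>s\<in>{0<..1}.
     (\<forall>u\<in>weighted_L2. T s u \<in> Hol \<and> T s u \<in> weighted_L2 \<and> sq_norm (T s u) \<le> C\<^sup>2 * sq_norm u) \<and>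
     (\<forall>u\<in>weighted_L2. \<forall>v\<in>weighted_L2. T s (\<lambda>x. u x + v x) = (\<lambda>x. T s u x + T s v x)) \<and>
     (\<forall>u\<in>weighted_L2. \<forall>c. T s (\<lambda>x. c * u x) = (\<lambda>x. c * T s u x)) \<and>
     (\<forall>u\<in>Hol. (\<exists>A. \<forall>y. norm (u y) \<le> A * (decay y * exp (Re (H y y)))) \<longrightarrow>
        T s u = weyl (\<lambda>m. b (s *\<^sub>R m)) u))"
proof -
  define T where "T = (\<lambda>s u. bergman (weighted_op (weyl_kernel (\<lambda>m. b (s *\<^sub>R m))) u))"
  obtain P where P: "\<And>x z. norm (bergman_kernel x z) \<le> P * decay (x - z)"
    using bergman_kernel_bound_ex by blast
  obtain M where M: "\<And>s x z. s \<in> {0<..1} \<Longrightarrow> norm (weyl_kernel (\<lambda>m. b (s *\<^sub>R m)) x z) \<le> M * decay (x - z)"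
    using weyl_kernel_bound[OF b bound] by blast
  obtain B where B: "\<And>x. norm (b x) \<le> B" using bound[of "[]"] by auto
  have "\<forall>x. b differentiable (at x)" using b unfolding smooth_def by (metis iter_deriv.simps(1) lists.Nil)
  then have "continuous_on UNIV b"
    by (meson continuous_at_imp_continuous_on differentiable_imp_continuous_within)
  then have [measurable]: "b \<in> borel_measurable borel" by (rule borel_measurable_continuous_onI)
  let ?J = "integral\<^sup>L lborel (decay :: complex ^ 'n \<Rightarrow> real)"
  define C where "C = \<bar>(P * ?J) * (M * ?J)\<bar>"
  show ?thesis
  proof (intro exI[of _ T] exI[of _ C] conjI ballI)
    show "C \<ge> 0" by (simp add: C_def)
    fix s :: real assume s: "s \<in> {0<..1}"
    let ?b = "\<lambda>m. b (s *\<^sub>R m)"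
    let ?W = "weighted_op (weyl_kernel ?b)"
    have bm: "?b \<in> borel_measurable borel" by measurable
    note mW = measurable_weyl_kernel[OF bm] and mP = measurable_bergman_kernel
    have W: "?W u \<in> weighted_L2" if "u \<in> weighted_L2" for u
      by (rule weighted_op_L2[OF mW M[OF s] that])
    fix u assume u: "u \<in> weighted_L2"
    show "T s u \<in> Hol" unfolding T_def by (rule Hol_bergman[OF W[OF u]])
    show "T s u \<in> weighted_L2" unfolding T_def by (rule weighted_op_L2[OF mP P W[OF u]])
    have "sq_norm (T s u) \<le> (P * ?J)\<^sup>2 * sq_norm (?W u)"
      unfolding T_def by (rule weighted_op_bound[OF mP P W[OF u]])
    also have "\<dots> \<le> (P * ?J)\<^sup>2 * ((M * ?J)\<^sup>2 * sq_norm u)"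
      by (intro mult_left_mono weighted_op_bound[OF mW M[OF s] u]) auto
    finally show "sq_norm (T s u) \<le> C\<^sup>2 * sq_norm u"
      by (simp add: C_def power_mult_distrib mult.assoc)
    show "T s (\<lambda>x. u x + v x) = (\<lambda>x. T s u x + T s v x)" if v: "v \<in> weighted_L2" for v
      unfolding T_def weighted_op_linear(1)[OF mW M[OF s] u v]
      by (rule weighted_op_linear(1)[OF mP P W[OF u] W[OF v]])
    show "\<forall>c. T s (\<lambda>x. c * u x) = (\<lambda>x. c * T s u x)"
      unfolding T_def weighted_op_linear(2)[OF mW M[OF s] u u]
      using weighted_op_linear(2)[OF mP P W[OF u] W[OF u]] by blast
  next
    fix s :: real and u :: "complex ^ 'n \<Rightarrow> complex"
    assume s: "s \<in> {0<..1}" and u: "u \<in> Hol"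
    let ?b = "\<lambda>m. b (s *\<^sub>R m)"
    have bm: "?b \<in> borel_measurable borel" by measurable
    show "(\<exists>A. \<forall>y. norm (u y) \<le> A * (decay y * exp (Re (H y y)))) \<longrightarrow> T s u = weyl ?b u"
    proof (intro impI, elim exE)
      fix A assume A: "\<forall>y. norm (u y) \<le> A * (decay y * exp (Re (H y y)))"
      have "weighted_op (weyl_kernel ?b) u = weyl ?b u"
        by (rule ext, rule weyl_eq_weighted_op[OF bm B u A[rule_format], symmetric])
      moreover have "bergman (weyl ?b u) = weyl ?b u"
        by (rule ext, rule bergman_weyl[OF bm B u A[rule_format]])
      ultimately show "T s u = weyl ?b u" by (simp add: T_def)
    qed
  qed
qed

end

section \<open>Reduction of a quadratic weight to its Hermitian part\<close>

lemma frechet_derivative_linear: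
  "linear f \<Longrightarrow> frechet_derivative f (at x) = f" for f :: "'a::euclidean_space \<Rightarrow> 'b::real_normed_vector"
  by (metis bounded_linear_imp_has_derivative frechet_derivative_at linear_conv_bounded_linear)

text \<open>Let \<open>B\<close> be the symmetric bilinear form of \<open>\<Phi>\<close>. Then \<open>D(m,v) = B(m,v) - \<i> B(m,\<i> v)\<close> is \<open>\<partial>\<Phi>(m) \<cdot> v\<close>, which is
  complex linear in \<open>v\<close> and only real linear in \<open>m\<close>. Its antilinear part in \<open>m\<close> is \<open>H\<close>, the polarized Levi
  form, and its linear part is \<open>Q\<close>.\<close>

lemma quadratic_weight_decomposition:
  fixes \<Phi> :: "complex ^ 'n \<Rightarrow> real"
  assumes quad: "quadratic_form \<Phi>" and psh: "strictly_psh \<Phi>"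
  obtains H Q where "positive_hermitian_form H"
    and "\<And>x y z. Q (x + y) z = Q x z + Q y z" "\<And>c x y. Q (c *s x) y = c * Q x y" "\<And>x y. Q x y = Q y x"
    and "\<And>x. \<Phi> x = Re (H x x) + Re (Q x x)"
    and "\<And>m v. \<i> * cdot v (Lambda_fibre \<Phi> m) = 2 * (H v m + Q v m)"
    and "\<And>x. contour_density \<Phi> x = contour_density \<Phi> 0"
proof -
  obtain B0 where B0: "bilinear B0" "\<And>x. \<Phi> x = B0 x x"
    using quad unfolding quadratic_form_def by blast
  define B where "B x y = (B0 x y + B0 y x) / 2" for x y
  have B_add: "B (x + y) z = B x z + B y z" "B z (x + y) = B z x + B z y" for x y z
    using B0(1) by (simp_all add: B_def bilinear_ladd bilinear_radd field_simps)
  have B_scale: "B (r *\<^sub>R x) z = r * B x z" "B z (r *\<^sub>R x) = r * B z x" for r x z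
    using B0(1) by (simp_all add: B_def bilinear_lmul bilinear_rmul field_simps)
  have B_sym: "B x y = B y x" for x y by (simp add: B_def)
  have B_bil: "bilinear B" unfolding bilinear_def by (auto intro!: linearI simp: B_add B_scale)
  have \<Phi>: "\<Phi> x = B x x" for x by (simp add: B0 B_def)
  have smult: "c *s v = Re c *\<^sub>R v + Im c *\<^sub>R (\<i> *s v)" for c and v :: "complex ^ 'n"
    by (simp add: scaleR_eq_smult vec_eq_iff complex_eq_iff)
  define D where "D m v = complex_of_real (B m v) - \<i> * complex_of_real (B m (\<i> *s v))" for m v
  have D_add: "D (m + m') v = D m v + D m' v" "D m (v + v') = D m v + D m v'" for m m' v v'
    by (simp_all add: D_def B_add algebra_simps vector_add_ldistrib)
  have D_scaleR: "D (r *\<^sub>R m) v = r *\<^sub>R D m v" for r m v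
    by (simp add: D_def B_scale scaleR_conv_of_real[where 'a=complex] algebra_simps)
  have D_smult: "D m (c *s v) = c * D m v" for c m v
  proof -
    have "\<i> *s (c *s v) = (- Im c) *\<^sub>R v + Re c *\<^sub>R (\<i> *s v)"
      using smult[of "\<i> * c" v] by simp
    then have "B m (\<i> *s (c *s v)) = - Im c * B m v + Re c * B m (\<i> *s v)"
      by (simp only: B_add B_scale)
    moreover have "B m (c *s v) = Re c * B m v + Im c * B m (\<i> *s v)"
      by (subst smult) (simp only: B_add B_scale)
    ultimately show ?thesis
      unfolding D_def by (simp add: complex_eq_iff)
  qed
  define H where "H v m = (D m v + \<i> * D (\<i> *s m) v) / 2" for v m
  define Q where "Q v m = (D m v - \<i> * D (\<i> *s m) v) / 2" for v m
  have HQ: "H v m + Q v m = D m v" for v m by (simp add: H_def Q_def field_simps)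
  have H_add: "H (v + w) m = H v m + H w m" and Q_add: "Q (v + w) m = Q v m + Q w m" for v w m
    by (simp_all add: H_def Q_def D_add field_simps)
  have H_smult: "H (c *s v) m = c * H v m" and Q_smult: "Q (c *s v) m = c * Q v m" for c v m
    by (simp_all add: H_def Q_def D_smult field_simps)
  have H_herm: "H m v = cnj (H v m)" and Q_sym: "Q v m = Q m v" for v m
    by (simp_all add: H_def Q_def D_def complex_eq_iff B_sym[of m] B_sym[of "\<i> *s m"])
  have der\<Phi>: "frechet_derivative (\<lambda>z. complex_of_real (\<Phi> z)) (at x) = (\<lambda>v. complex_of_real (2 * B x v))" for x
  proof -
    interpret bounded_bilinear B using B_bil bilinear_conv_bounded_bilinear by blast
    have "((\<lambda>z. complex_of_real (B z z)) has_derivative (\<lambda>v. complex_of_real (B x v + B v x))) (at x)"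
      by (rule has_derivative_of_real[OF FDERIV[OF has_derivative_ident has_derivative_ident]])
    then show ?thesis
      using frechet_derivative_at by (fastforce simp: \<Phi> B_sym[of _ x])
  qed
  have ax: "axis j \<i> = \<i> *s axis j (1::complex)" for j :: 'n
    by (simp add: vec_eq_iff axis_def)
  have wirt: "wirt j (\<lambda>z. complex_of_real (\<Phi> z)) x = D x (axis j 1)" for j x
    by (simp add: wirt_def der\<Phi> D_def ax)
  have wirt_fun: "wirt j (\<lambda>z. complex_of_real (\<Phi> z)) = (\<lambda>x. D x (axis j 1))" for j
    by (rule ext) (rule wirt)
  have lin_D: "linear (\<lambda>m. D m v)" for v
    by (intro linearI) (simp_all add: D_add D_scaleR)
  have levi: "levi_matrix \<Phi> x $ j $ k = H (axis k 1) (axis j 1)" for x j k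
    by (simp add: levi_matrix_def wirt_fun wirt_bar_def frechet_derivative_linear[OF lin_D] H_def ax)
  have lin_H: "linear (\<lambda>v. H v m)" for m
    by (intro linearI) (simp_all add: H_add scaleR_eq_smult H_smult scaleR_conv_of_real[where 'a=complex])
  have H_expand: "H v m = (\<Sum>k\<in>UNIV. v $ k * H (axis k 1) m)" for v m
  proof -
    have "H v m = H (\<Sum>k\<in>UNIV. v $ k *s axis k 1) m" by (simp add: basis_expansion)
    also have "\<dots> = (\<Sum>k\<in>UNIV. v $ k * H (axis k 1) m)"
      by (simp add: linear_sum[OF lin_H] H_smult)
    finally show ?thesis .
  qed
  have levi_form: "(\<Sum>j\<in>UNIV. \<Sum>k\<in>UNIV. levi_matrix \<Phi> x $ j $ k * cnj (\<xi> $ j) * \<xi> $ k) = H \<xi> \<xi>" for x \<xi>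
  proof -
    have "H \<xi> \<xi> = cnj (H \<xi> \<xi>)" by (rule H_herm)
    also have "\<dots> = cnj (\<Sum>j\<in>UNIV. \<xi> $ j * H (axis j 1) \<xi>)" by (rule arg_cong[OF H_expand])
    also have "\<dots> = (\<Sum>j\<in>UNIV. cnj (\<xi> $ j) * H \<xi> (axis j 1))"
      by (simp only: cnj_sum complex_cnj_mult H_herm[symmetric])
    also have "\<dots> = (\<Sum>j\<in>UNIV. cnj (\<xi> $ j) * (\<Sum>k\<in>UNIV. \<xi> $ k * H (axis k 1) (axis j 1)))"
      by (intro sum.cong refl arg_cong2[where f = "(*)"] H_expand)
    finally show ?thesis by (simp add: levi sum_distrib_left mult_ac)
  qed
  have "positive_hermitian_form H"
  proof
    show "Re (H x x) > 0" if "x \<noteq> 0" for x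
      using psh that unfolding strictly_psh_def levi_form by blast
  qed (fact H_add H_smult H_herm)+
  moreover have "\<Phi> x = Re (H x x) + Re (Q x x)" for x
    using arg_cong[OF HQ[of x x], of Re] by (simp add: D_def \<Phi>)
  moreover have "\<i> * cdot v (Lambda_fibre \<Phi> m) = 2 * (H v m + Q v m)" for m v
  proof -
    have lin: "linear (D m)"
      by (intro linearI) (simp_all add: D_add scaleR_eq_smult D_smult scaleR_conv_of_real[where 'a=complex])
    have "D m v = D m (\<Sum>j\<in>UNIV. v $ j *s axis j 1)" by (simp add: basis_expansion)
    also have "\<dots> = (\<Sum>j\<in>UNIV. v $ j * D m (axis j 1))" by (simp add: linear_sum[OF lin] D_smult)
    finally show ?thesis
      by (simp add: cdot_def Lambda_fibre_def wirt HQ sum_distrib_left mult_ac)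
  qed
  moreover have "contour_density \<Phi> x = contour_density \<Phi> 0" for x
  proof -
    have "levi_matrix \<Phi> x = levi_matrix \<Phi> 0" by (simp add: vec_eq_iff levi)
    then show ?thesis by (simp add: contour_density_def)
  qed
  ultimately show thesis using that Q_add Q_smult Q_sym by blast
qed

locale quadratic_weight = positive_hermitian_form H
  for H :: "complex ^ 'n \<Rightarrow> complex ^ 'n \<Rightarrow> complex" +
  fixes Q :: "complex ^ 'n \<Rightarrow> complex ^ 'n \<Rightarrow> complex" and \<Phi> :: "complex ^ 'n \<Rightarrow> real"
  assumes Q_add: "Q (x + y) z = Q x z + Q y z" and Q_smult: "Q (c *s x) y = c * Q x y"
    and Q_sym: "Q x y = Q y x"
    and weight: "\<Phi> x = Re (H x x) + Re (Q x x)"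
begin

lemma Q_add_right: "Q z (x + y) = Q z x + Q z y"
  using Q_add[of x y z] by (simp add: Q_sym[of z])

lemma Q_smult_right: "Q z (c *s x) = c * Q z x"
  using Q_smult[of c x z] by (simp add: Q_sym[of z])

lemma Q_diff: "Q (x - y) z = Q x z - Q y z" "Q z (x - y) = Q z x - Q z y"
  using Q_add[of "x - y" y z] Q_add_right[of z "x - y" y] by simp_all

lemma Q_scaleR: "Q (r *\<^sub>R x) y = r * Q x y" "Q x (r *\<^sub>R y) = r * Q x y"
  by (simp_all add: scaleR_eq_smult Q_smult Q_smult_right)

lemma Hol_Q: "(\<lambda>x. Q x x) \<in> Hol"
proof -
  have "bilinear Q"
    unfolding bilinear_def
    by (auto intro!: linearI simp: Q_add Q_add_right Q_scaleR scaleR_conv_of_real[where 'a=complex])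
  then interpret q: bounded_bilinear Q using bilinear_conv_bounded_bilinear by blast
  have "((\<lambda>x. Q x x) has_derivative (\<lambda>h. Q x h + Q h x)) (at x)" for x
    by (rule q.FDERIV[OF has_derivative_ident has_derivative_ident])
  then show ?thesis
    unfolding Hol_def
    by (auto intro!: exI[of _ "\<lambda>h. Q x h + Q h x" for x] simp: Q_smult Q_smult_right distrib_left)
qed

text \<open>Up to the constant \<open>h\<^bsup>n/2\<^esup>\<close>, a unitary map from \<open>H\<^sub>\<Phi>\<close> at parameter \<open>h\<close> onto the space with weight \<open>H\<close> at
  parameter 1: the factor \<open>e\<^bsup>-Q\<^esup>\<close> removes the pluriharmonic part of the weight.\<close>

definition to_model :: "real \<Rightarrow> (complex ^ 'n \<Rightarrow> complex) \<Rightarrow> complex ^ 'n \<Rightarrow> complex" where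
  "to_model h u x = exp (- Q x x) * u (sqrt h *\<^sub>R x)"

definition from_model :: "real \<Rightarrow> (complex ^ 'n \<Rightarrow> complex) \<Rightarrow> complex ^ 'n \<Rightarrow> complex" where
  "from_model h w x = exp (Q x x / h) * w ((1 / sqrt h) *\<^sub>R x)"

lemma to_from_model: "h > 0 \<Longrightarrow> to_model h (from_model h w) = w"
  by (rule ext) (simp add: to_model_def from_model_def Q_scaleR mult.assoc[symmetric]
      flip: exp_add of_real_mult)

lemma Hol_to_model: "u \<in> Hol \<Longrightarrow> to_model h u \<in> Hol"
proof -
  assume u: "u \<in> Hol"
  have "(\<lambda>x. exp (-1 * Q x x) * u (of_real (sqrt h) *s x + 0)) \<in> Hol"
    by (intro Hol_mult Hol_exp Hol_const Hol_Q Hol_affine u)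
  then show ?thesis by (simp add: to_model_def[abs_def] scaleR_eq_smult)
qed

lemma Hol_from_model: "w \<in> Hol \<Longrightarrow> from_model h w \<in> Hol"
proof -
  assume w: "w \<in> Hol"
  have "(\<lambda>x. exp ((1 / of_real h) * Q x x) * w (of_real (1 / sqrt h) *s x + 0)) \<in> Hol"
    by (intro Hol_mult Hol_exp Hol_const Hol_Q Hol_affine w)
  then show ?thesis by (simp add: from_model_def[abs_def] scaleR_eq_smult)
qed

lemma to_model_density:
  assumes "h > 0"
  shows "(norm (to_model h u x))\<^sup>2 * exp (- 2 * Re (H x x))
     = (norm (u (sqrt h *\<^sub>R x)))\<^sup>2 * exp (- 2 * \<Phi> (sqrt h *\<^sub>R x) / h)"
proof -
  have "\<Phi> (sqrt h *\<^sub>R x) = h * (Re (H x x) + Re (Q x x))"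
    using assms by (simp add: weight expand Q_scaleR mult.assoc[symmetric] distrib_left flip: of_real_mult)
  then have "- 2 * \<Phi> (sqrt h *\<^sub>R x) / h = - 2 * Re (Q x x) + - 2 * Re (H x x)"
    using assms by simp
  moreover have "(norm (exp (- Q x x)))\<^sup>2 = exp (- 2 * Re (Q x x))"
    by (simp add: norm_exp_eq_Re flip: exp_double)
  ultimately show ?thesis
    by (simp only: to_model_def norm_mult power_mult_distrib exp_add mult_ac)
qed

lemma H_Phi_iff:
  assumes "h > 0"
  shows "u \<in> H_Phi \<Phi> h \<longleftrightarrow> u \<in> Hol \<and> to_model h u \<in> weighted_L2"
proof -
  let ?N = "\<lambda>x. (norm (u x))\<^sup>2 * exp (- 2 * \<Phi> x / h)"
  have "to_model h u \<in> borel_measurable borel" if "u \<in> Hol"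
    using that by (intro Hol_measurable Hol_to_model)
  moreover have "integrable lborel (\<lambda>x. (norm (to_model h u x))\<^sup>2 * exp (- 2 * Re (H x x))) \<longleftrightarrow> integrable lborel ?N"
    unfolding to_model_density[OF assms]
    using integrable_lborel_affine_iff[of "sqrt h" ?N 0] assms by simp
  ultimately show ?thesis
    unfolding H_Phi_def weighted_L2_def by auto
qed

lemma H_norm_eq:
  assumes "h > 0"
  shows "H_norm \<Phi> h u = sqrt (sqrt h ^ DIM(complex ^ 'n) * sq_norm (to_model h u))"
  unfolding H_norm_def sq_norm_def to_model_density[OF assms]
  by (subst integral_lborel_affine[of "sqrt h" _ 0]) (use assms in auto)

text \<open>Decay of order \<open>2 D\<close>, with \<open>D\<close> the real dimension, gives the weight \<open>decay\<close>. The constant may blow up as \<open>h \<rightarrow> 0\<close>: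
  the decay serves to identify the operator at fixed \<open>h\<close> and not to bound it.\<close>

lemma rapid_to_model:
  assumes h: "h \<in> {0<..1}" and u: "u \<in> rapid_Hol \<Phi> h"
  shows "\<exists>A. \<forall>y. norm (to_model h u y) \<le> A * (decay y * exp (Re (H y y)))"
proof -
  let ?D = "DIM(complex ^ 'n)"
  obtain C where C: "\<And>x. norm (u x) \<le> C * (1 / japanese x ^ (2 * ?D)) * exp (\<Phi> x / h)"
    using u unfolding rapid_Hol_def by blast
  have C0: "C \<ge> 0"
    using order_trans[OF norm_ge_zero C[of 0]] by (simp add: japanese_def zero_le_mult_iff not_le[symmetric])
  have "norm (to_model h u y) \<le> (C / h ^ ?D) * (decay y * exp (Re (H y y)))" for y
  proof -
    let ?y = "sqrt h *\<^sub>R y"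
    have j: "japanese ?y ^ (2 * ?D) = (1 + h * (norm y)\<^sup>2) ^ ?D"
    proof -
      have "(norm ?y)\<^sup>2 = h * (norm y)\<^sup>2" using h by (simp add: power_mult_distrib)
      moreover have "0 \<le> 1 + h * (norm y)\<^sup>2" using h by simp
      ultimately show ?thesis by (simp only: japanese_def power_mult real_sqrt_pow2)
    qed
    have y: "(norm y)\<^sup>2 \<ge> 0" by simp
    have "(h * (1 + (norm y)\<^sup>2)) ^ ?D \<le> (1 + h * (norm y)\<^sup>2) ^ ?D"
      using h by (intro power_mono) (auto simp: distrib_left)
    moreover have "0 < (h * (1 + (norm y)\<^sup>2)) ^ ?D"
      using h y by (intro zero_less_power mult_pos_pos add_pos_nonneg) auto
    ultimately have "1 / japanese ?y ^ (2 * ?D) \<le> 1 / (h * (1 + (norm y)\<^sup>2)) ^ ?D"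
      unfolding j by (intro divide_left_mono mult_pos_pos) auto
    also have "\<dots> = decay y / h ^ ?D" by (simp add: decay_def power_mult_distrib mult.commute)
    finally have jd: "1 / japanese ?y ^ (2 * ?D) \<le> decay y / h ^ ?D" .
    have ph: "\<Phi> ?y / h = Re (H y y) + Re (Q y y)"
      using h by (simp add: weight expand Q_scaleR mult.assoc[symmetric] add_divide_distrib flip: of_real_mult)
    have "norm (to_model h u y) \<le> exp (- Re (Q y y)) * (C * (1 / japanese ?y ^ (2 * ?D)) * exp (\<Phi> ?y / h))"
      unfolding to_model_def norm_mult norm_exp_eq_Re by (intro mult_mono C) auto
    also have "\<dots> \<le> exp (- Re (Q y y)) * (C * (decay y / h ^ ?D) * exp (\<Phi> ?y / h))"
      using C0 by (intro mult_left_mono mult_right_mono jd) auto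
    also have "\<dots> = (C / h ^ ?D) * (decay y * (exp (Re (H y y)) * (exp (- Re (Q y y)) * exp (Re (Q y y)))))"
      unfolding ph exp_add by simp
    finally show ?thesis by (simp flip: exp_add)
  qed
  then show ?thesis by blast
qed

text \<open>The phase is \<open>(1/h) (H + Q)(x - y, x + y)\<close>, and \<open>Q(x - y, x + y) = Q(x,x) - Q(y,y)\<close> since \<open>Q\<close> is symmetric, so \<open>Q\<close>
  enters through the conjugation only. The Jacobian \<open>h\<^sup>n\<close> of the dilation cancels the power of \<open>h\<close> in front
  of the integral, so that \<open>h\<close> remains only in the dilated symbol.\<close>

lemma Op_w_eq:
  fixes a :: "(complex ^ 'n) \<times> (complex ^ 'n) \<Rightarrow> complex"
  assumes h: "h > 0"
    and fibre: "\<And>m v. \<i> * cdot v (Lambda_fibre \<Phi> m) = 2 * (H v m + Q v m)"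
    and dens: "\<And>x. contour_density \<Phi> x = contour_density \<Phi> 0"
  defines "b \<equiv> \<lambda>x. a (x, Lambda_fibre \<Phi> x)"
  shows "Op_w \<Phi> h a u = from_model h (\<lambda>x. contour_density \<Phi> 0 / (2 * pi) ^ CARD('n) *
           weyl (\<lambda>m. b (sqrt h *\<^sub>R m)) (to_model h u) x)"
proof
  fix x :: "complex ^ 'n"
  let ?s = "sqrt h" and ?c = "contour_density \<Phi> 0"
  let ?x = "(1 / ?s) *\<^sub>R x"
  have s: "?s > 0" "?s * ?s = h" "complex_of_real ?s * of_real ?s = of_real h"
    using h by (simp_all flip: of_real_mult)
  let ?f = "\<lambda>y. let m = (1 / 2) *\<^sub>R (x + y); \<theta> = Lambda_fibre \<Phi> m in
        exp (\<i> / complex_of_real h * cdot (x - y) \<theta>) * a (m, \<theta>) * u y * contour_density \<Phi> m"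
  let ?g = "\<lambda>y. exp (H (?x - y) (?x + y)) * b (?s *\<^sub>R ((1/2) *\<^sub>R (?x + y))) * to_model h u y"
  have f: "?f (?s *\<^sub>R y) = ?c * exp (Q x x / h) * ?g y" for y
  proof -
    let ?m = "(1 / 2) *\<^sub>R (x + ?s *\<^sub>R y)"
    have x: "x = ?s *\<^sub>R ?x" using s by simp
    have m: "?m = ?s *\<^sub>R ((1/2) *\<^sub>R (?x + y))" using s by (simp add: scaleR_add_right)
    have v: "x - ?s *\<^sub>R y = ?s *\<^sub>R (?x - y)" using s by (simp add: scaleR_diff_right)
    have hh: "complex_of_real h \<noteq> 0" using h by simp
    have "\<i> / complex_of_real h * cdot (x - ?s *\<^sub>R y) (Lambda_fibre \<Phi> ?m)
       = (2 * (H (x - ?s *\<^sub>R y) ?m + Q (x - ?s *\<^sub>R y) ?m)) / h"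
      unfolding fibre[symmetric] by simp
    also have "\<dots> = H (?x - y) (?x + y) + Q (?x - y) (?x + y)"
    proof -
      have "H (?s *\<^sub>R v) (?s *\<^sub>R ((1/2) *\<^sub>R w)) = of_real h * H v w / 2"
        "Q (?s *\<^sub>R v) (?s *\<^sub>R ((1/2) *\<^sub>R w)) = of_real h * Q v w / 2" for v w
        using s by (simp_all add: scaleR_left scaleR_right Q_scaleR mult.assoc[symmetric])
      moreover have "2 * (t * p / 2 + t * q / 2) = t * (p + q)" for t p q :: complex
        by (simp add: distrib_left)
      ultimately have "2 * (H (x - ?s *\<^sub>R y) ?m + Q (x - ?s *\<^sub>R y) ?m)
          = of_real h * (H (?x - y) (?x + y) + Q (?x - y) (?x + y))"
        unfolding m v by (simp only:)
      then show ?thesis using hh by simp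
    qed
    also have "Q (?x - y) (?x + y) = Q x x / h + - Q y y"
    proof -
      have "Q ?x ?x = Q x x / h"
        using s by (simp only: Q_scaleR) (simp add: field_simps flip: of_real_mult)
      then show ?thesis by (simp add: Q_diff Q_add_right Q_sym[of y ?x])
    qed
    finally have e: "exp (\<i> / complex_of_real h * cdot (x - ?s *\<^sub>R y) (Lambda_fibre \<Phi> ?m))
        = exp (H (?x - y) (?x + y)) * (exp (Q x x / h) * exp (- Q y y))"
      by (simp only: exp_add)
    have "?f (?s *\<^sub>R y) = exp (\<i> / complex_of_real h * cdot (x - ?s *\<^sub>R y) (Lambda_fibre \<Phi> ?m))
        * b ?m * u (?s *\<^sub>R y) * ?c"
      by (simp add: Let_def b_def dens[of ?m])
    also have "\<dots> = ?c * exp (Q x x / h) * ?g y"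
      unfolding e unfolding m to_model_def by (simp only: mult_ac)
    finally show ?thesis .
  qed
  have "(\<integral>y. ?f y \<partial>lborel) = ?s ^ DIM(complex ^ 'n) *\<^sub>R (\<integral>y. ?f (?s *\<^sub>R y) \<partial>lborel)"
    using integral_lborel_affine[of ?s ?f 0] s(1) by simp
  also have "\<dots> = ?s ^ DIM(complex ^ 'n) *\<^sub>R (?c * exp (Q x x / h) * weyl (\<lambda>m. b (?s *\<^sub>R m)) (to_model h u) ?x)"
    unfolding f weyl_def by simp
  also have "?s ^ DIM(complex ^ 'n) = h ^ CARD('n)"
    using h by (simp add: mult.commute[of "CARD('n)"] power_mult)
  finally have I: "(\<integral>y. ?f y \<partial>lborel) = h ^ CARD('n) *\<^sub>R (?c * exp (Q x x / h) * weyl (\<lambda>m. b (?s *\<^sub>R m)) (to_model h u) ?x)" .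
  show "Op_w \<Phi> h a u x = from_model h (\<lambda>x. ?c / (2 * pi) ^ CARD('n) * weyl (\<lambda>m. b (?s *\<^sub>R m)) (to_model h u) x) x"
    unfolding Op_w_def I from_model_def using h
    by (simp add: scaleR_conv_of_real power_mult_distrib field_simps)
qed

lemma to_model_linear:
  "to_model h (\<lambda>x. u x + v x) = (\<lambda>x. to_model h u x + to_model h v x)"
  "to_model h (\<lambda>x. c * u x) = (\<lambda>x. c * to_model h u x)"
  by (auto simp: to_model_def algebra_simps)

lemma sq_norm_cmult: "sq_norm (\<lambda>x. c * u x) = (norm c)\<^sup>2 * sq_norm u"
  by (simp add: sq_norm_def norm_mult power_mult_distrib mult.assoc)

lemma weighted_L2_cmult: "u \<in> weighted_L2 \<Longrightarrow> (\<lambda>x. c * u x) \<in> weighted_L2"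
  by (auto simp: weighted_L2_def norm_mult power_mult_distrib mult.assoc)

end

lemma H_norm_nonneg: "H_norm \<Phi> h u \<ge> 0"
  unfolding H_norm_def by simp

lemma operator_norm_H_bounds:
  fixes \<Phi> :: "complex ^ 'n \<Rightarrow> real"
  assumes "C \<ge> 0" and T: "\<And>u. u \<in> H_Phi \<Phi> h \<Longrightarrow> H_norm \<Phi> h (T u) \<le> C * H_norm \<Phi> h u"
  shows "0 \<le> operator_norm_H \<Phi> h T" "operator_norm_H \<Phi> h T \<le> C"
proof -
  let ?S = "{u \<in> H_Phi \<Phi> h. H_norm \<Phi> h u \<le> 1}"
  have 0: "(\<lambda>_. 0) \<in> ?S"
    by (auto simp: H_Phi_def H_norm_def)
  have le: "H_norm \<Phi> h (T u) \<le> C" if "u \<in> ?S" for u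
    using T[of u] that mult_left_mono[of "H_norm \<Phi> h u" 1 C] assms(1) by auto
  show "operator_norm_H \<Phi> h T \<le> C"
    unfolding operator_norm_H_def using 0 le by (intro cSUP_least) blast+
  show "0 \<le> operator_norm_H \<Phi> h T"
    unfolding operator_norm_H_def using le
    by (intro cSUP_upper2[OF _ 0 H_norm_nonneg] bdd_aboveI2[where M = C]) blast
qed

theorem theorem1p4p1:
  fixes \<Phi> :: "complex ^ 'n \<Rightarrow> real"
    and a :: "(complex ^ 'n) \<times> (complex ^ 'n) \<Rightarrow> complex"
  assumes "quadratic_form \<Phi>" and "strictly_psh \<Phi>"
    and "a \<in> symbol_class \<Phi>"
  shows "\<exists>T :: real \<Rightarrow> (complex ^ 'n \<Rightarrow> complex) \<Rightarrow> complex ^ 'n \<Rightarrow> complex.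
           (\<forall>h\<in>{0<..1}. bounded_operator_H \<Phi> h (T h) \<and>
                        (\<forall>u\<in>rapid_Hol \<Phi> h. T h u = Op_w \<Phi> h a u)) \<and>
           (\<lambda>h. operator_norm_H \<Phi> h (T h)) \<in> O[at_right 0](\<lambda>_. 1)"
proof -
  obtain H Q where HQ: "positive_hermitian_form H"
    "\<And>x y z. Q (x + y) z = Q x z + Q y z" "\<And>c x y. Q (c *s x) y = c * Q x y" "\<And>x y. Q x y = Q y x"
    "\<And>x. \<Phi> x = Re (H x x) + Re (Q x x)"
    and fibre: "\<And>m v. \<i> * cdot v (Lambda_fibre \<Phi> m) = 2 * (H v m + Q v m)"
    and dens: "\<And>x. contour_density \<Phi> x = contour_density \<Phi> 0"
    by (rule quadratic_weight_decomposition[OF assms(1,2)]) blast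
  interpret quadratic_weight H Q \<Phi>
    using HQ by (simp add: quadratic_weight_def quadratic_weight_axioms_def)
  define b where "b x = a (x, Lambda_fibre \<Phi> x)" for x
  have b: "smooth b" "\<And>vs. vs \<in> lists Basis \<Longrightarrow> \<exists>C. \<forall>x. norm (iter_deriv vs b x) \<le> C"
    using assms(3) by (simp_all add: symbol_class_def b_def[abs_def] Let_def)
  obtain S C where C: "C \<ge> 0"
    and S: "\<forall>s\<in>{0<..1}.
     (\<forall>u\<in>weighted_L2. S s u \<in> Hol \<and> S s u \<in> weighted_L2 \<and> sq_norm (S s u) \<le> C\<^sup>2 * sq_norm u) \<and>
     (\<forall>u\<in>weighted_L2. \<forall>v\<in>weighted_L2. S s (\<lambda>x. u x + v x) = (\<lambda>x. S s u x + S s v x)) \<and>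
     (\<forall>u\<in>weighted_L2. \<forall>c. S s (\<lambda>x. c * u x) = (\<lambda>x. c * S s u x)) \<and>
     (\<forall>u\<in>Hol. (\<exists>A. \<forall>y. norm (u y) \<le> A * (decay y * exp (Re (H y y)))) \<longrightarrow>
        S s u = weyl (\<lambda>m. b (s *\<^sub>R m)) u)"
    using bounded_weyl_extension[OF b] by blast
  \<comment> \<open>the constant of \<open>Op_w_eq\<close>, which does not depend on \<open>h\<close>\<close>
  define c where "c = contour_density \<Phi> 0 / (2 * pi) ^ CARD('n)"
  define T where "T h u = from_model h (\<lambda>x. c * S (sqrt h) (to_model h u) x)" for h u
  have main: "bounded_operator_H \<Phi> h (T h) \<and> (\<forall>u\<in>rapid_Hol \<Phi> h. T h u = Op_w \<Phi> h a u)"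
    and norm: "\<And>u. u \<in> H_Phi \<Phi> h \<Longrightarrow> H_norm \<Phi> h (T h u) \<le> (norm c * C) * H_norm \<Phi> h u"
    if h: "h \<in> {0<..1}" for h
  proof -
    have h0: "h > 0" and s: "sqrt h \<in> {0<..1}" using h by auto
    note Sh = S[rule_format, OF s]
    note mem = H_Phi_iff[OF h0]
    have T_model: "to_model h (T h u) = (\<lambda>x. c * S (sqrt h) (to_model h u) x)" for u
      unfolding T_def by (rule to_from_model[OF h0])
    show norm: "H_norm \<Phi> h (T h u) \<le> (norm c * C) * H_norm \<Phi> h u" if u: "u \<in> H_Phi \<Phi> h" for u
    proof -
      have "sq_norm (to_model h (T h u)) \<le> (norm c * C)\<^sup>2 * sq_norm (to_model h u)"
        using Sh u unfolding T_model sq_norm_cmult mem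
        by (simp add: power_mult_distrib mult.assoc mult_left_mono)
      then have "sqrt h ^ DIM(complex ^ 'n) * sq_norm (to_model h (T h u))
         \<le> (norm c * C)\<^sup>2 * (sqrt h ^ DIM(complex ^ 'n) * sq_norm (to_model h u))"
        using mult_left_mono[of _ _ "sqrt h ^ DIM(complex ^ 'n)"] h0 by (simp add: mult.left_commute)
      then have "H_norm \<Phi> h (T h u) \<le> sqrt ((norm c * C)\<^sup>2 * (sqrt h ^ DIM(complex ^ 'n) * sq_norm (to_model h u)))"
        unfolding H_norm_eq[OF h0] by (rule real_sqrt_le_mono)
      also have "\<dots> = (norm c * C) * H_norm \<Phi> h u"
        using C by (simp only: H_norm_eq[OF h0] real_sqrt_mult real_sqrt_abs) (simp add: abs_mult)
      finally show ?thesis .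
    qed
    have "bounded_operator_H \<Phi> h (T h)"
      unfolding bounded_operator_H_def
    proof (intro conjI ballI allI)
      fix u assume u: "u \<in> H_Phi \<Phi> h"
      then have u': "to_model h u \<in> weighted_L2" by (simp add: mem)
      have "(\<lambda>x. c * S (sqrt h) (to_model h u) x) \<in> Hol"
        using Sh u' by (intro Hol_mult Hol_const) blast
      then have "T h u \<in> Hol" unfolding T_def by (rule Hol_from_model)
      then show "T h u \<in> H_Phi \<Phi> h"
        using Sh u' unfolding mem T_model by (blast intro: weighted_L2_cmult)
      show "T h (\<lambda>x. u x + v x) = (\<lambda>x. T h u x + T h v x)" if "v \<in> H_Phi \<Phi> h" for v
        using Sh u' that by (auto simp: mem T_def to_model_linear from_model_def distrib_left)
      show "T h (\<lambda>x. k * u x) = (\<lambda>x. k * T h u x)" for k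
        using Sh u' by (auto simp: T_def to_model_linear from_model_def)
    qed (use norm in blast)
    moreover have "T h u = Op_w \<Phi> h a u" if u: "u \<in> rapid_Hol \<Phi> h" for u
    proof -
      have "to_model h u \<in> Hol" using u by (intro Hol_to_model) (simp add: rapid_Hol_def)
      then have "S (sqrt h) (to_model h u) = weyl (\<lambda>m. b (sqrt h *\<^sub>R m)) (to_model h u)"
        using Sh rapid_to_model[OF h u] by blast
      then show ?thesis
        unfolding T_def c_def Op_w_eq[OF h0 fibre dens] b_def by simp
    qed
    ultimately show "bounded_operator_H \<Phi> h (T h) \<and> (\<forall>u\<in>rapid_Hol \<Phi> h. T h u = Op_w \<Phi> h a u)" by blast
  qed
  have "(\<lambda>h. operator_norm_H \<Phi> h (T h)) \<in> O[at_right 0](\<lambda>_. 1)"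
  proof (rule bigoI)
    have "\<forall>\<^sub>F h in at_right 0. h \<in> {0<..<1::real}"
      by (rule eventually_at_right_real) simp
    then show "\<forall>\<^sub>F h in at_right 0. norm (operator_norm_H \<Phi> h (T h)) \<le> (norm c * C) * norm (1::real)"
    proof eventually_elim
      case (elim h)
      have "0 \<le> norm c * C" using C by simp
      from operator_norm_H_bounds[OF this norm[of h]] elim show ?case by simp
    qed
  qed
  with main show ?thesis by blast
qed

end
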